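(* Assume the standing setting and Hypothesis $(H_a)$. Then $\tau$ is in the limit circle case at $a$ if and only if its regularization index at $a$ satisfies $\ell_a=0$.
   Context: Standing setting: Let $-\infty\le a<b\le\infty$ and let $p,q,r$ be Lebesgue measurable functions on $(a,b)$ with $r>0$ a.e., $r\in L^1_{loc}((a,b))$; $p>0$ a.e., $1/p\in L^1_{loc}((a,b))$; $q$ real-valued a.e., $q\in L^1_{loc}((a,b))$. Let $\tau f=\frac1r\big[-(pf')'+qf\big]$ act on functions $f$ with $f,pf'\in AC_{loc}((a,b))$; write $f^{[1]}=pf'$ and $W(f,g)=fg^{[1]}-f^{[1]}g$. For $\lambda\in\mathbb R$, the equation $\tau f=\lambda f$ is nonoscillatory at $a$ if its nontrivial real solutions have finitely many zeros near $a$; then there is a solution $u_a$, unique up to constant multiples, with $\lim_{x\to a^+}u_a(x)/v_a(x)=0$ for every solution $v_a$ linearly independent of $u_a$; $u_a$ is called principal at $a$ and any such $v_a$ nonprincipal at $a$. $\tau$ is in the limit circle case at $a$ if for some (equivalently all) $\mu\in\mathbb C$ all solutions of $\tau f=\mu f$ lie in $L^2((a,c);r(x)dx)$ for $c\in(a,b)$; otherwise it is in the limit point case at $a$. Hypothesis $(H_a)$: there exist $\lambda\in\mathbb R$ such that $\tau f=\lambda f$ is nonoscillatory at $a$, and $c\in(a,b)$, such that $\int_a^c|u_a(x)v_a(x)r(x)|\,dx<\infty$, where $u_a$, $v_a$ are principal resp. nonprincipal solutions of $\tau f=\lambda f$ at $a$. Construction (C): fix $\lambda\in\mathbb R$ as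 in $(H_a)$ and let $u_a$ (principal) and $v_a$ (nonprincipal) be solutions of $\tau f=\lambda f$ with $W(v_a,u_a)=1$. Set $\varphi_0=u_a$, $\varphi_n(x)=\int_a^x[u_a(t)v_a(x)-v_a(t)u_a(x)]\varphi_{n-1}(t)r(t)\,dt$ for $n\ge1$, $x\in(a,b)$, and $\varphi(z,x)=\sum_{n\ge0}\varphi_n(x)(z-\lambda)^n$; this series converges for all $z\in\mathbb C$, $x\in(a,b)$, is entire in $z$ and solves $\tau\varphi(z,\cdot)=z\varphi(z,\cdot)$. Definition (RI): let $\theta(z,x)$ be any solution of $\tau\theta(z,\cdot)=z\theta(z,\cdot)$, entire in $z$ for each $x$, real for real $z$, with $W(\theta(z,\cdot),\varphi(z,\cdot))=1$, and write $\theta(z,x)=\sum_{n\ge0}\theta_n(x)(z-\lambda)^n$ (same $\lambda$ as in (C)). The limits $\lim_{x\to a^+}\varphi_0(x)/\theta_n(x)$ exist in $\mathbb R\cup\{\pm\infty\}$. The regularization index $\ell_a\in\mathbb N_0\cup\{\infty\}$ at $a$ is the smallest integer $\ell\ge0$ with $\lim_{x\to a^+}\varphi_0(x)/\theta_n(x)=0$ for $n=0,\dots,\ell$ and $\lim_{x\to a^+}\varphi_0(x)/\theta_{\ell+1}(x)\neq0$; if $\lim_{x\to a^+}\varphi_0(x)/\theta_n(x)=0$ for all $n\ge0$, then $\ell_a=\infty$. ($\ell_a$ does not depend on the choice of $\theta$ or of the constant normalization of $\varphi$.) *)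

theory Defs
  imports "HOL-Analysis.Analysis"
begin

definition ivl :: "ereal \<Rightarrow> ereal \<Rightarrow> real set" where
  "ivl a b = {x. a < ereal x \<and> ereal x < b}"

text \<open>The filter x \<rightarrow> a+ (a is the left endpoint, a < b so a is not +infinity).\<close>
definition at_left_end :: "ereal \<Rightarrow> real filter" where
  "at_left_end a = (if a = -\<infinity> then at_bot else at_right (real_of_ereal a))"

definition abs_cont_on :: "real set \<Rightarrow> (real \<Rightarrow> 'a::real_normed_vector) \<Rightarrow> bool" where
  "abs_cont_on S f \<longleftrightarrow>
     (\<forall>e>0. \<exists>d>0. \<forall>(n::nat) (s::nat \<Rightarrow> real) t.
        (\<forall>i<n. s i \<le> t i \<and> {s i..t i} \<subseteq> S) \<and>
        (\<forall>i<n. \<forall>j<n. i \<noteq> j \<longrightarrow> {s i<..<t i} \<inter> {s j<..<t j} = {}) \<and>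
        (\<Sum>i<n. t i - s i) < d \<longrightarrow> (\<Sum>i<n. norm (f (t i) - f (s i))) < e)"

definition AC_loc :: "real set \<Rightarrow> (real \<Rightarrow> 'a::real_normed_vector) \<Rightarrow> bool" where
  "AC_loc I f \<longleftrightarrow> (\<forall>c d. {c..d} \<subseteq> I \<longrightarrow> abs_cont_on {c..d} f)"

definition L1_loc :: "real set \<Rightarrow> (real \<Rightarrow> real) \<Rightarrow> bool" where
  "L1_loc I f \<longleftrightarrow> (\<forall>c d. {c..d} \<subseteq> I \<longrightarrow> f absolutely_integrable_on {c..d})"

definition SL_setting :: "ereal \<Rightarrow> ereal \<Rightarrow> (real \<Rightarrow> real) \<Rightarrow> (real \<Rightarrow> real) \<Rightarrow> (real \<Rightarrow> real) \<Rightarrow> bool" where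
  "SL_setting a b p q r \<longleftrightarrow> a < b \<and>
     p \<in> borel_measurable (lebesgue_on (ivl a b)) \<and>
     q \<in> borel_measurable (lebesgue_on (ivl a b)) \<and>
     r \<in> borel_measurable (lebesgue_on (ivl a b)) \<and>
     (AE x in lebesgue. x \<in> ivl a b \<longrightarrow> r x > 0) \<and> L1_loc (ivl a b) r \<and>
     (AE x in lebesgue. x \<in> ivl a b \<longrightarrow> p x > 0) \<and> L1_loc (ivl a b) (\<lambda>x. 1 / p x) \<and>
     L1_loc (ivl a b) q"

definition is_sol :: "ereal \<Rightarrow> ereal \<Rightarrow> (real \<Rightarrow> real) \<Rightarrow> (real \<Rightarrow> real) \<Rightarrow> (real \<Rightarrow> real)
    \<Rightarrow> 'a::real_normed_field \<Rightarrow> (real \<Rightarrow> 'a) \<Rightarrow> (real \<Rightarrow> 'a) \<Rightarrow> bool" where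
  "is_sol a b p q r z f g \<longleftrightarrow>
     AC_loc (ivl a b) f \<and> AC_loc (ivl a b) g \<and>
     (AE x in lebesgue. x \<in> ivl a b \<longrightarrow>
        (\<exists>f'. (f has_vector_derivative f') (at x) \<and> of_real (p x) * f' = g x)) \<and>
     (AE x in lebesgue. x \<in> ivl a b \<longrightarrow>
        (g has_vector_derivative ((of_real (q x) - z * of_real (r x)) * f x)) (at x))"

definition nonosc_at_a :: "ereal \<Rightarrow> ereal \<Rightarrow> (real \<Rightarrow> real) \<Rightarrow> (real \<Rightarrow> real) \<Rightarrow> (real \<Rightarrow> real)
    \<Rightarrow> real \<Rightarrow> bool" where
  "nonosc_at_a a b p q r lam \<longleftrightarrow>
     (\<forall>f g. is_sol a b p q r lam f g \<and> (\<exists>x\<in>ivl a b. f x \<noteq> 0) \<longrightarrow>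
        (\<exists>c\<in>ivl a b. finite {x. a < ereal x \<and> x < c \<and> f x = 0}))"

definition principal_at_a :: "ereal \<Rightarrow> ereal \<Rightarrow> (real \<Rightarrow> real) \<Rightarrow> (real \<Rightarrow> real) \<Rightarrow> (real \<Rightarrow> real)
    \<Rightarrow> real \<Rightarrow> (real \<Rightarrow> real) \<Rightarrow> bool" where
  "principal_at_a a b p q r lam u \<longleftrightarrow>
     (\<exists>g. is_sol a b p q r lam u g) \<and> (\<exists>x\<in>ivl a b. u x \<noteq> 0) \<and>
     (\<forall>v g. is_sol a b p q r lam v g \<and> \<not> (\<exists>k. \<forall>x\<in>ivl a b. v x = k * u x) \<longrightarrow>
        ((\<lambda>x. u x / v x) \<longlongrightarrow> 0) (at_left_end a))"

definition limit_circle_at_a :: "ereal \<Rightarrow> ereal \<Rightarrow> (real \<Rightarrow> real) \<Rightarrow> (real \<Rightarrow> real) \<Rightarrow> (real \<Rightarrow> real) \<Rightarrow> bool" where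
  "limit_circle_at_a a b p q r \<longleftrightarrow>
     (\<exists>mu::complex. \<forall>f g c. is_sol a b p q r mu f g \<and> c \<in> ivl a b \<longrightarrow>
        (\<lambda>x. (cmod (f x))\<^sup>2 * r x) absolutely_integrable_on {x. a < ereal x \<and> x < c})"

fun phi_n :: "ereal \<Rightarrow> (real \<Rightarrow> real) \<Rightarrow> (real \<Rightarrow> real) \<Rightarrow> (real \<Rightarrow> real) \<Rightarrow> nat \<Rightarrow> real \<Rightarrow> real" where
  "phi_n a r u v 0 = u"
| "phi_n a r u v (Suc n) = (\<lambda>x. LINT t:{t. a < ereal t \<and> t < x}|lebesgue.
       (u t * v x - v t * u x) * phi_n a r u v n t * r t)"

definition phi :: "ereal \<Rightarrow> (real \<Rightarrow> real) \<Rightarrow> (real \<Rightarrow> real) \<Rightarrow> (real \<Rightarrow> real) \<Rightarrow> real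
    \<Rightarrow> complex \<Rightarrow> real \<Rightarrow> complex" where
  "phi a r u v lam z x = (\<Sum>n. complex_of_real (phi_n a r u v n x) * (z - complex_of_real lam) ^ n)"

text \<open>Taylor coefficients theta_n(x) of z \<mapsto> theta(z,x) at lam (real by realness of theta).\<close>
definition theta_coeff :: "(complex \<Rightarrow> real \<Rightarrow> complex) \<Rightarrow> real \<Rightarrow> nat \<Rightarrow> real \<Rightarrow> real" where
  "theta_coeff theta lam n x = Re ((deriv ^^ n) (\<lambda>z. theta z x) (complex_of_real lam) / of_nat (fact n))"

definition reg_index :: "real filter \<Rightarrow> (real \<Rightarrow> real) \<Rightarrow> (nat \<Rightarrow> real \<Rightarrow> real) \<Rightarrow> enat" where
  "reg_index F phi0 th =
     (let L = (\<lambda>n. Lim F (\<lambda>x. ereal (phi0 x / th n x))) in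
      if \<forall>n. L n = 0 then \<infinity>
      else enat (LEAST l. (\<forall>n\<le>l. L n = 0) \<and> L (Suc l) \<noteq> 0))"

end

theory Submission
  imports Defs
begin

text \<open>
  Put \<open>W = \<theta>\<^sub>0/u\<close>, where \<open>\<theta>\<^sub>0 = \<theta>(\<lambda>, \<cdot>)\<close>. Near \<open>a\<close> it satisfies \<open>W' = -1/(p u\<^sup>2)\<close>, so it decreases
  strictly from \<open>+\<infinity>\<close>, and \<open>\<phi>\<^sub>1/u = -N\<close> with \<open>N(x) = \<integral>\<^sub>a\<^sup>x (W(t) - W(x)) u\<^sup>2 r dt\<close>. For real \<open>z\<close> the quotient
  \<open>\<theta>(z)/\<phi>(z)\<close> has derivative \<open>-1/(p \<phi>(z)\<^sup>2)\<close>; comparing it with \<open>W\<close> and differentiating in \<open>z\<close> at \<open>\<lambda>\<close>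
  encloses the increments of \<open>h = \<theta>\<^sub>1/u\<close> so tightly that
  \<open>h(x) - h(y) = \<integral>\<^sub>a\<^sup>y W(t) (min (W(t)) (W(x)) - W(y)) u\<^sup>2 r dt\<close> for \<open>x < y\<close>. Hence \<open>h\<close> is strictly decreasing, and it is
  bounded near \<open>a\<close> iff \<open>W\<^sup>2 u\<^sup>2 r = \<theta>\<^sub>0\<^sup>2 r\<close> is integrable there, which is the limit circle case. Since
  \<open>u/\<theta>\<^sub>1 = 1/h\<close>, boundedness of \<open>h\<close> means exactly that \<open>u/\<theta>\<^sub>1\<close> does not tend to \<open>0\<close>.
\<close>

section \<open>The fundamental theorem of calculus for absolutely continuous functions\<close>

text \<open>The obstacle is that \<open>theta\<close> is given solution by solution: nothing is
  known about how the quasi-derivatives depend on z, so no differential equation for theta_1 is at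
  hand. Formally, differentiating (theta/phi)' = -1/(p phi^2) in z at \<open>lam\<close> gives d(h +
  W N) = 2 N dW, that is dh = N dW - W dN. Rather than justify the interchange of derivatives, the
  proof integrates in x first, for real z = \<open>lam\<close> + e with e > 0, where phi/u = 1 - e N
  + O(e^2) uniformly near a, and then differentiates in e with x and y fixed. This gives only an
  enclosure of h(x) - h(y). Its width 2 (W(x) - W(y)) (N(y) - N(x)) is a product of two increments,
  the increment of the truncated integral obeys the same enclosure, and a second-order gap
  disappears under subdivision. The minimum with W(x) keeps that integral finite when only W u^2 r
  is known to be integrable, as (H_a) provides.\<close>

lemma abs_cont_on_finite_family:
  fixes f :: "real \<Rightarrow> 'a::real_normed_vector"
  assumes "abs_cont_on S f" "e > 0"
  obtains d where "d > 0"
    "\<And>(P::'b set) s t. \<lbrakk>finite P; \<And>i. i \<in> P \<Longrightarrow> s i \<le> t i \<and> {s i..t i} \<subseteq> S;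
        \<And>i j. \<lbrakk>i \<in> P; j \<in> P; i \<noteq> j\<rbrakk> \<Longrightarrow> {s i<..<t i} \<inter> {s j<..<t j} = {};
        (\<Sum>i\<in>P. t i - s i) < d\<rbrakk> \<Longrightarrow> (\<Sum>i\<in>P. norm (f (t i) - f (s i))) < e"
proof -
  from assms(1)[unfolded abs_cont_on_def, THEN spec, THEN mp, OF assms(2)]
  obtain d where d: "d > 0" and *: "\<forall>(n::nat) (s::nat \<Rightarrow> real) t.
        (\<forall>i<n. s i \<le> t i \<and> {s i..t i} \<subseteq> S) \<and>
        (\<forall>i<n. \<forall>j<n. i \<noteq> j \<longrightarrow> {s i<..<t i} \<inter> {s j<..<t j} = {}) \<and>
        (\<Sum>i<n. t i - s i) < d \<longrightarrow> (\<Sum>i<n. norm (f (t i) - f (s i))) < e"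
    by (elim exE conjE)
  show thesis
  proof (rule that[OF d])
    fix P :: "'b set" and s t
    assume fin: "finite P" and sub: "\<And>i. i \<in> P \<Longrightarrow> s i \<le> t i \<and> {s i..t i} \<subseteq> S"
      and disj: "\<And>i j. \<lbrakk>i \<in> P; j \<in> P; i \<noteq> j\<rbrakk> \<Longrightarrow> {s i<..<t i} \<inter> {s j<..<t j} = {}"
      and len: "(\<Sum>i\<in>P. t i - s i) < d"
    \<comment> \<open>\<open>abs_cont_on\<close> speaks of families indexed by an initial segment of
      the naturals, whereas gauge sums run over sets of tagged intervals; a bijection renames the
      indices.\<close>
    obtain b where b: "bij_betw b {..<card P} P"
      using ex_bij_betw_nat_finite[OF fin] by (auto simp: lessThan_atLeast0)
    have mem: "b i \<in> P" if "i < card P" for i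
      using b that by (auto simp: bij_betw_def)
    have inj: "b i \<noteq> b j" if "i < card P" "j < card P" "i \<noteq> j" for i j
      using b that by (auto simp: bij_betw_def inj_on_def)
    have "(\<Sum>i<card P. norm (f (t (b i)) - f (s (b i)))) < e"
      by (rule *[rule_format]) (use sub mem disj inj len in
          \<open>auto simp: sum.reindex_bij_betw[OF b, of "\<lambda>i. t i - s i"]\<close>)
    then show "(\<Sum>i\<in>P. norm (f (t i) - f (s i))) < e"
      by (simp add: sum.reindex_bij_betw[OF b, of "\<lambda>i. norm (f (t i) - f (s i))"])
  qed
qed

text \<open>The pieces overlap only in boundary points, so their lengths add up to the measure of
  their union. This is applied to the pieces tagged in the exceptional set, all of which lie in a
  small open cover.\<close>

lemma sum_length_tagged_partial_le:
  fixes P :: "(real \<times> real set) set"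
  assumes P: "P tagged_partial_division_of S" and U: "U \<in> lmeasurable"
    and sub: "\<And>x K. (x, K) \<in> P \<Longrightarrow> K \<subseteq> U"
  shows "(\<Sum>(x,K)\<in>P. Sup K - Inf K) \<le> measure lebesgue U"
proof -
  note D = tagged_partial_division_ofD[OF P]
  have eq: "Sup K - Inf K = measure lebesgue K" if xK: "(x, K) \<in> P" for x K
  proof -
    obtain s t where "K = cbox s t" using D(4)[OF xK] by blast
    moreover have "x \<in> K" using D(2)[OF xK] .
    ultimately show ?thesis by auto
  qed
  have "(\<Sum>(x,K)\<in>P. Sup K - Inf K) = (\<Sum>i\<in>P. measure lebesgue (snd i))"
    by (intro sum.cong) (auto simp: eq)
  also have "\<dots> = measure lebesgue (\<Union>(snd ` P))"
  proof (rule measure_negligible_finite_Union_image[symmetric])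
    show "finite P" by fact
    show "snd x \<in> lmeasurable" if "x \<in> P" for x
      using that D(4)[of "fst x" "snd x"] by auto
    show "pairwise (\<lambda>x y. negligible (snd x \<inter> snd y)) P"
    proof (rule pairwiseI)
      fix i j assume ij: "i \<in> P" "j \<in> P" "i \<noteq> j"
      obtain x K y L where eqs: "i = (x, K)" "j = (y, L)" by force
      obtain s t s' t' where KL: "K = cbox s t" "L = cbox s' t'"
        using D(4) ij eqs by meson
      have "interior K \<inter> interior L = {}"
        using D(5)[of x K y L] ij eqs by auto
      moreover have "convex (K \<inter> L)"
        unfolding KL by (intro convex_Int convex_box)
      ultimately show "negligible (snd i \<inter> snd j)"
        using negligible_convex_interior[of "K \<inter> L"] eqs by simp
    qed
  qed
  also have "\<dots> \<le> measure lebesgue U"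
  proof (rule measure_mono_fmeasurable)
    show "\<Union>(snd ` P) \<subseteq> U" using sub by force
    have "snd x \<in> sets lebesgue" if "x \<in> P" for x
      using that D(4)[of "fst x" "snd x"] by auto
    then show "\<Union>(snd ` P) \<in> sets lebesgue" using D(1) by auto
  qed fact
  finally show ?thesis .
qed

text \<open>The gauge treats two kinds of tags. Outside \<open>N\<close>, differentiability bounds
  the error on a piece by a small multiple of its length. The pieces tagged in \<open>N\<close> lie
  in an open set of measure below \<delta>, so absolute continuity bounds the sum of their
  increments.\<close>

theorem fundamental_theorem_of_calculus_abs_cont:
  fixes f :: "real \<Rightarrow> 'a::banach"
  assumes ab: "a \<le> b" and ac: "abs_cont_on {a..b} f" and neg: "negligible N"
    and deriv: "\<And>x. x \<in> {a..b} - N \<Longrightarrow> (f has_vector_derivative f' x) (at x within {a..b})"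
  shows "(f' has_integral (f b - f a)) {a..b}"
proof -
  \<comment> \<open>With value 0 on \<open>N\<close>, a piece tagged there contributes just its
    increment of \<open>f\<close>; the negligible change is undone at the end.\<close>
  define g where "g x = (if x \<in> N then 0 else f' x)" for x
  have "(g has_integral (f b - f a)) (cbox a b)"
    unfolding has_integral
  proof safe
    fix e :: real assume e: "e > 0"
    \<comment> \<open>The \<open>+ 1\<close> keeps the denominator positive when
      \<open>a = b\<close>.\<close>
    define e' where "e' = e / (2 * (b - a + 1))"
    have e': "e' > 0" "e' * (b - a) < e / 2"
      using e ab unfolding e'_def by (auto simp: field_simps)
    obtain \<delta> where \<delta>: "\<delta> > 0" and AC:
      "\<And>(P::(real \<times> real set) set) s t. \<lbrakk>finite P; \<And>i. i \<in> P \<Longrightarrow> s i \<le> t i \<and> {s i..t i} \<subseteq> {a..b};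
        \<And>i j. \<lbrakk>i \<in> P; j \<in> P; i \<noteq> j\<rbrakk> \<Longrightarrow> {s i<..<t i} \<inter> {s j<..<t j} = {};
        (\<Sum>i\<in>P. t i - s i) < \<delta>\<rbrakk> \<Longrightarrow> (\<Sum>i\<in>P. norm (f (t i) - f (s i))) < e / 2"
      by (rule abs_cont_on_finite_family[OF ac half_gt_zero[OF e]]) blast
    obtain U where U: "open U" "N \<subseteq> U" "U \<in> lmeasurable" "measure lebesgue U < \<delta>"
    proof -
      have N0: "N \<in> null_sets lebesgue" using neg negligible_iff_null_sets by blast
      obtain T where T: "open T" "N \<subseteq> T" "T - N \<in> lmeasurable" "emeasure lebesgue (T - N) < ennreal \<delta>"
        using sets_lebesgue_outer_open[of N \<delta>] N0 \<delta> by blast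
      have "T = (T - N) \<union> N" using T by auto
      then have "T \<in> lmeasurable"
        using T(3) negligible_imp_measurable[OF neg] by (metis fmeasurable.Un)
      moreover have "measure lebesgue T = measure lebesgue (T - N)"
        using N0 T(1) by (simp add: measure_Diff_null_set)
      moreover have "measure lebesgue (T - N) < \<delta>"
        using T(4) emeasure_eq_measure2[OF T(3)] by (simp add: ennreal_less_iff)
      ultimately show thesis using that[OF T(1,2)] by simp
    qed
    have "\<exists>d>0. (x \<in> N \<longrightarrow> ball x d \<subseteq> U) \<and> (x \<in> {a..b} - N \<longrightarrow> (\<forall>y\<in>{a..b}. norm (y-x) < d \<longrightarrow>
             norm (f y - f x - (y-x) *\<^sub>R f' x) \<le> e' * norm (y-x)))" for x
    proof (cases "x \<in> N")
      case True
      then show ?thesis using U open_contains_ball[of U] by auto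
    next
      case False
      show ?thesis
      proof (cases "x \<in> {a..b}")
        case True
        then show ?thesis
          using False deriv[of x, unfolded has_vector_derivative_def has_derivative_within_alt] e'(1) by auto
      qed (use False in \<open>auto intro: exI[of _ 1]\<close>)
    qed
    then obtain d where d: "\<And>x. d x > 0" "\<And>x. x \<in> N \<Longrightarrow> ball x (d x) \<subseteq> U"
      "\<And>x y. x \<in> {a..b} - N \<Longrightarrow> y \<in> {a..b} \<Longrightarrow> norm (y-x) < d x \<Longrightarrow>
             norm (f y - f x - (y-x) *\<^sub>R f' x) \<le> e' * norm (y-x)"
      by metis
    show "\<exists>\<gamma>. gauge \<gamma> \<and> (\<forall>\<D>. \<D> tagged_division_of cbox a b \<and> \<gamma> fine \<D> \<longrightarrow>
        norm ((\<Sum>(x, K)\<in>\<D>. measure lborel K *\<^sub>R g x) - (f b - f a)) < e)"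
    proof (rule exI, safe)
      show "gauge (\<lambda>x. ball x (d x))"
        using d(1) gauge_ball_dependent by blast
    next
      fix p assume ptag: "p tagged_division_of cbox a b" and fine: "(\<lambda>x. ball x (d x)) fine p"
      note D = tagged_division_ofD[OF ptag]
      have fin: "finite p" by fact
      have ba: "b - a = (\<Sum>(x,K)\<in>p. Sup K - Inf K)" "f b - f a = (\<Sum>(x,K)\<in>p. f(Sup K) - f(Inf K))"
        using additive_tagged_division_1[where f= "\<lambda>x. x"] additive_tagged_division_1[where f= f]
            ab ptag by auto
      have interval: "\<exists>s t. K = {s..t} \<and> s \<le> t \<and> a \<le> s \<and> t \<le> b \<and> s \<le> x \<and> x \<le> t
           \<and> Inf K = s \<and> Sup K = t \<and> measure lborel K = t - s \<and> {s..t} \<subseteq> ball x (d x)" if xK: "(x, K) \<in> p" for x K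
      proof -
        obtain s t where K: "K = cbox s t" using D(4)[OF xK] by blast
        have "x \<in> K" "K \<subseteq> {a..b}" using D(2,3)[OF xK] by auto
        then have "s \<le> t" "a \<le> s" "t \<le> b" "s \<le> x" "x \<le> t" using K by auto
        moreover have "K \<subseteq> ball x (d x)" using fine xK by (auto simp: fine_def)
        ultimately show ?thesis using K by (intro exI[of _ s] exI[of _ t]) auto
      qed
      define A where "A = {i \<in> p. fst i \<in> N}"
      define B where "B = {i \<in> p. fst i \<notin> N}"
      have AB: "p = A \<union> B" "A \<inter> B = {}" "finite A" "finite B"
        using fin unfolding A_def B_def by auto
      define F where "F = (\<lambda>(x, K). measure lborel K *\<^sub>R g x - (f (Sup K) - f (Inf K)))"
      have "(\<Sum>(x, K)\<in>p. measure lborel K *\<^sub>R g x) - (f b - f a) = sum F p"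
        unfolding ba F_def by (simp add: sum_subtractf split_def)
      also have "\<dots> = sum F A + sum F B"
        using AB by (simp add: sum.union_disjoint)
      finally have split: "norm ((\<Sum>(x, K)\<in>p. measure lborel K *\<^sub>R g x) - (f b - f a)) \<le> norm (sum F A) + norm (sum F B)"
        by (simp add: norm_triangle_ineq)
      have "norm (sum F A) \<le> (\<Sum>i\<in>A. norm (f (Sup (snd i)) - f (Inf (snd i))))"
        by (rule sum_norm_le) (auto simp: F_def A_def g_def norm_minus_commute)
      also have "\<dots> < e / 2"
      proof (rule AC[where s="\<lambda>i. Inf (snd i)" and t="\<lambda>i. Sup (snd i)"])
        show "finite A" by fact
        show "Inf (snd i) \<le> Sup (snd i) \<and> {Inf (snd i)..Sup (snd i)} \<subseteq> {a..b}" if iA: "i \<in> A" for i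
        proof -
          obtain s t where "a \<le> s" "t \<le> b" "s \<le> t" "Inf (snd i) = s" "Sup (snd i) = t"
            using iA interval[of "fst i" "snd i"] unfolding A_def by auto
          then show ?thesis by auto
        qed
        show "{Inf (snd i)<..<Sup (snd i)} \<inter> {Inf (snd j)<..<Sup (snd j)} = {}"
          if ij: "i \<in> A" "j \<in> A" "i \<noteq> j" for i j
        proof -
          have "interior (snd i) \<inter> interior (snd j) = {}"
            using D(5)[of "fst i" "snd i" "fst j" "snd j"] ij by (auto simp: A_def prod_eq_iff)
          moreover have "interior (snd i) = {Inf (snd i)<..<Sup (snd i)}"
            using interval[of "fst i" "snd i"] ij unfolding A_def by (metis (lifting) CollectD interior_atLeastAtMost_real prod.collapse)
          moreover have "interior (snd j) = {Inf (snd j)<..<Sup (snd j)}"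
            using interval[of "fst j" "snd j"] ij unfolding A_def by (metis (lifting) CollectD interior_atLeastAtMost_real prod.collapse)
          ultimately show ?thesis by simp
        qed
        have "A tagged_partial_division_of cbox a b"
          using ptag unfolding A_def
          by (auto simp: tagged_division_of_def intro: tagged_partial_division_subset)
        moreover have "K \<subseteq> U" if "(x, K) \<in> A" for x K
          using that d(2)[of x] interval[of x K] by (auto simp: A_def)
        ultimately have "(\<Sum>(x,K)\<in>A. Sup K - Inf K) \<le> measure lebesgue U"
          using U(3) by (blast intro: sum_length_tagged_partial_le)
        then show "(\<Sum>i\<in>A. Sup (snd i) - Inf (snd i)) < \<delta>"
          using U(4) by (simp add: split_def)
      qed
      finally have 1: "norm (sum F A) < e / 2" .
      have "norm (sum F B) \<le> (\<Sum>i\<in>B. e' * (Sup (snd i) - Inf (snd i)))"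
      proof (rule sum_norm_le)
        fix i assume i: "i \<in> B"
        obtain x K where xK: "i = (x, K)" by force
        obtain s t where st: "K = {s..t}" "s \<le> t" "a \<le> s" "t \<le> b" "s \<le> x" "x \<le> t"
           "Inf K = s" "Sup K = t" "measure lborel K = t - s" "{s..t} \<subseteq> ball x (d x)"
          using interval[of x K] i xK unfolding B_def by auto
        have x: "x \<in> {a..b} - N" "x \<notin> N" using i xK st unfolding B_def by auto
        have "s \<in> ball x (d x)" "t \<in> ball x (d x)" using st(2,10) by (auto simp del: mem_ball)
        then have "norm (f s - f x - (s-x) *\<^sub>R f' x) \<le> e' * norm (s-x)"
          "norm (f t - f x - (t-x) *\<^sub>R f' x) \<le> e' * norm (t-x)"
          using st x d(3)[of x s] d(3)[of x t] by (auto simp: dist_real_def)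
        \<comment> \<open>The tag lies between the endpoints, so |s - x| + |t - x| is the length of
          the piece and the two linear errors together stay below \<open>e'\<close> times that
          length.\<close>
        moreover have "F i = (f s - f x - (s-x) *\<^sub>R f' x) - (f t - f x - (t-x) *\<^sub>R f' x)"
          using x by (simp add: F_def xK st(7-9) g_def algebra_simps)
        ultimately have "norm (F i) \<le> e' * norm (s-x) + e' * norm (t-x)"
          using norm_triangle_ineq4 order_trans add_mono by metis
        then show "norm (F i) \<le> e' * (Sup (snd i) - Inf (snd i))"
          using st xK by (simp add: algebra_simps)
      qed
      also have "\<dots> \<le> (\<Sum>i\<in>p. e' * (Sup (snd i) - Inf (snd i)))"
      proof (rule sum_mono2)
        show "0 \<le> e' * (Sup (snd i) - Inf (snd i))" if "i \<in> p - B" for i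
          using that e' interval[of "fst i" "snd i"] by auto
      qed (use AB fin in auto)
      also have "\<dots> = e' * (b - a)"
        unfolding ba by (simp add: sum_distrib_left split_def)
      finally show "norm ((\<Sum>(x, K)\<in>p. measure lborel K *\<^sub>R g x) - (f b - f a)) < e"
        using split 1 e' by linarith
    qed
  qed
  then show ?thesis
    using has_integral_spike[OF neg, of "{a..b}" f' g "f b - f a"] by (auto simp: g_def)
qed

section \<open>Closure properties of absolute continuity, obtained from one domination
  estimate\<close>

lemma abs_cont_on_dominated:
  fixes f :: "real \<Rightarrow> 'a::real_normed_vector" and g :: "real \<Rightarrow> 'b::real_normed_vector"
    and F :: "real \<Rightarrow> 'c::real_normed_vector"
  assumes f: "abs_cont_on S f" and g: "abs_cont_on S g" and K: "K > 0"
    and dom: "\<And>s t. s \<in> S \<Longrightarrow> t \<in> S \<Longrightarrow> norm (F t - F s) \<le> K * (norm (f t - f s) + norm (g t - g s))"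
  shows "abs_cont_on S F"
  unfolding abs_cont_on_def
proof (intro allI impI)
  fix e :: real assume "e > 0"
  then have e: "e / (2 * K) > 0" using K by simp
  obtain d1 where d1: "d1 > 0" "\<And>(P::nat set) s t. \<lbrakk>finite P; \<And>i. i \<in> P \<Longrightarrow> s i \<le> t i \<and> {s i..t i} \<subseteq> S;
        \<And>i j. \<lbrakk>i \<in> P; j \<in> P; i \<noteq> j\<rbrakk> \<Longrightarrow> {s i<..<t i} \<inter> {s j<..<t j} = {};
        (\<Sum>i\<in>P. t i - s i) < d1\<rbrakk> \<Longrightarrow> (\<Sum>i\<in>P. norm (f (t i) - f (s i))) < e / (2 * K)"
    by (rule abs_cont_on_finite_family[OF f e]) blast
  obtain d2 where d2: "d2 > 0" "\<And>(P::nat set) s t. \<lbrakk>finite P; \<And>i. i \<in> P \<Longrightarrow> s i \<le> t i \<and> {s i..t i} \<subseteq> S;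
        \<And>i j. \<lbrakk>i \<in> P; j \<in> P; i \<noteq> j\<rbrakk> \<Longrightarrow> {s i<..<t i} \<inter> {s j<..<t j} = {};
        (\<Sum>i\<in>P. t i - s i) < d2\<rbrakk> \<Longrightarrow> (\<Sum>i\<in>P. norm (g (t i) - g (s i))) < e / (2 * K)"
    by (rule abs_cont_on_finite_family[OF g e]) blast
  show "\<exists>d>0. \<forall>(n::nat) (s::nat \<Rightarrow> real) t.
        (\<forall>i<n. s i \<le> t i \<and> {s i..t i} \<subseteq> S) \<and>
        (\<forall>i<n. \<forall>j<n. i \<noteq> j \<longrightarrow> {s i<..<t i} \<inter> {s j<..<t j} = {}) \<and>
        (\<Sum>i<n. t i - s i) < d \<longrightarrow> (\<Sum>i<n. norm (F (t i) - F (s i))) < e"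
  proof (rule exI[of _ "min d1 d2"], intro conjI allI impI; (elim conjE)?)
    show "0 < min d1 d2" using d1 d2 by simp
    fix n :: nat and s t :: "nat \<Rightarrow> real"
    assume A: "\<forall>i<n. s i \<le> t i \<and> {s i..t i} \<subseteq> S"
      "\<forall>i<n. \<forall>j<n. i \<noteq> j \<longrightarrow> {s i<..<t i} \<inter> {s j<..<t j} = {}"
      "(\<Sum>i<n. t i - s i) < min d1 d2"
    have 1: "(\<Sum>i<n. norm (f (t i) - f (s i))) < e / (2 * K)"
      by (rule d1(2)) (use A in auto)
    have 2: "(\<Sum>i<n. norm (g (t i) - g (s i))) < e / (2 * K)"
      by (rule d2(2)) (use A in auto)
    have "(\<Sum>i<n. norm (F (t i) - F (s i))) \<le> (\<Sum>i<n. K * (norm (f (t i) - f (s i)) + norm (g (t i) - g (s i))))"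
    proof (rule sum_mono)
      fix i assume "i \<in> {..<n}"
      then have i: "s i \<le> t i" "{s i..t i} \<subseteq> S" using A(1) by auto
      then have "s i \<in> S" "t i \<in> S" by auto
      then show "norm (F (t i) - F (s i)) \<le> K * (norm (f (t i) - f (s i)) + norm (g (t i) - g (s i)))"
        by (rule dom)
    qed
    also have "\<dots> = K * ((\<Sum>i<n. norm (f (t i) - f (s i))) + (\<Sum>i<n. norm (g (t i) - g (s i))))"
      by (simp add: sum.distrib flip: sum_distrib_left)
    also have "\<dots> < K * (e / (2 * K) + e / (2 * K))"
      using 1 2 K by (intro mult_strict_left_mono add_strict_mono)
    also have "\<dots> = e" using K by simp
    finally show "(\<Sum>i<n. norm (F (t i) - F (s i))) < e" .
  qed
qed

lemma abs_cont_on_imp_continuous_on: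
  fixes f :: "real \<Rightarrow> 'a::real_normed_vector"
  assumes "abs_cont_on {c..d} f"
  shows "continuous_on {c..d} f"
  unfolding continuous_on_iff
proof (intro ballI allI impI)
  fix x e :: real assume x: "x \<in> {c..d}" and e: "e > 0"
  obtain \<delta> where \<delta>: "\<delta> > 0" and AC: "\<And>(P::unit set) s t. \<lbrakk>finite P; \<And>i. i \<in> P \<Longrightarrow> s i \<le> t i \<and> {s i..t i} \<subseteq> {c..d};
        \<And>i j. \<lbrakk>i \<in> P; j \<in> P; i \<noteq> j\<rbrakk> \<Longrightarrow> {s i<..<t i} \<inter> {s j<..<t j} = {};
        (\<Sum>i\<in>P. t i - s i) < \<delta>\<rbrakk> \<Longrightarrow> (\<Sum>i\<in>P. norm (f (t i) - f (s i))) < e"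
    by (rule abs_cont_on_finite_family[OF assms e]) blast
  have "dist (f y) (f x) < e" if y: "y \<in> {c..d}" "dist y x < \<delta>" for y
  proof -
    have "norm (f (max x y) - f (min x y)) < e"
      using AC[of "{()}" "\<lambda>_. min x y" "\<lambda>_. max x y"] x y by (auto simp: dist_real_def)
    then show ?thesis by (auto simp: dist_norm max_def min_def norm_minus_commute split: if_splits)
  qed
  then show "\<exists>\<delta>>0. \<forall>y\<in>{c..d}. dist y x < \<delta> \<longrightarrow> dist (f y) (f x) < e" using \<delta> by blast
qed

lemma abs_cont_on_bounded:
  fixes f :: "real \<Rightarrow> 'a::real_normed_vector"
  assumes "abs_cont_on {c..d} f"
  obtains B where "B > 0" "\<And>x. x \<in> {c..d} \<Longrightarrow> norm (f x) \<le> B"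
proof -
  have "bounded (f ` {c..d})"
    using abs_cont_on_imp_continuous_on[OF assms] compact_continuous_image compact_imp_bounded compact_Icc by blast
  then show thesis using that by (force simp: bounded_pos)
qed

lemma abs_cont_on_bounded_linear:
  assumes "bounded_linear T" "abs_cont_on S f"
  shows "abs_cont_on S (\<lambda>x. T (f x))"
proof -
  obtain K where K: "K > 0" "\<And>x. norm (T x) \<le> norm x * K"
    using bounded_linear.pos_bounded[OF assms(1)] by blast
  show ?thesis
  proof (rule abs_cont_on_dominated[OF assms(2) assms(2) K(1)])
    fix s t
    have "norm (T (f t) - T (f s)) \<le> norm (f t - f s) * K"
      using K(2)[of "f t - f s"] by (simp add: linear_diff[OF bounded_linear.linear[OF assms(1)]])
    also have "\<dots> \<le> K * (norm (f t - f s) + norm (f t - f s))"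
      using K(1) by (simp add: mult.commute)
    finally show "norm (T (f t) - T (f s)) \<le> K * (norm (f t - f s) + norm (f t - f s))" .
  qed
qed

lemma abs_cont_on_diff:
  assumes "abs_cont_on S f" "abs_cont_on S g"
  shows "abs_cont_on S (\<lambda>x. f x - g x)"
proof (rule abs_cont_on_dominated[OF assms zero_less_one])
  fix s t
  have "(f t - g t) - (f s - g s) = (f t - f s) - (g t - g s)" by simp
  then show "norm ((f t - g t) - (f s - g s)) \<le> 1 * (norm (f t - f s) + norm (g t - g s))"
    by (metis mult_1 norm_triangle_ineq4)
qed

lemma abs_cont_on_mult:
  fixes f g :: "real \<Rightarrow> 'a::real_normed_algebra"
  assumes f: "abs_cont_on {c..d} f" and g: "abs_cont_on {c..d} g"
  shows "abs_cont_on {c..d} (\<lambda>x. f x * g x)"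
proof -
  obtain B where B: "B > 0" "\<And>x. x \<in> {c..d} \<Longrightarrow> norm (f x) \<le> B"
    using abs_cont_on_bounded[OF f] by blast
  obtain C where C: "C > 0" "\<And>x. x \<in> {c..d} \<Longrightarrow> norm (g x) \<le> C"
    using abs_cont_on_bounded[OF g] by blast
  show ?thesis
  proof (rule abs_cont_on_dominated[OF f g, of "B + C"])
    show "B + C > 0" using B C by simp
    fix s t assume st: "s \<in> {c..d}" "t \<in> {c..d}"
    have "f t * g t - f s * g s = (f t - f s) * g t + f s * (g t - g s)"
      by (simp add: algebra_simps)
    then have "norm (f t * g t - f s * g s) \<le> norm (f t - f s) * norm (g t) + norm (f s) * norm (g t - g s)"
      by (metis add_mono norm_mult_ineq norm_triangle_le)
    also have "\<dots> \<le> norm (f t - f s) * (B + C) + (B + C) * norm (g t - g s)"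
      using B(2)[OF st(1)] C(2)[OF st(2)] B(1) C(1) by (intro add_mono mult_mono) auto
    finally show "norm (f t * g t - f s * g s) \<le> (B + C) * (norm (f t - f s) + norm (g t - g s))"
      by (simp add: algebra_simps)
  qed
qed

lemma abs_cont_on_inverse:
  fixes f :: "real \<Rightarrow> 'a::real_normed_field"
  assumes f: "abs_cont_on {c..d} f" and nz: "\<And>x. x \<in> {c..d} \<Longrightarrow> f x \<noteq> 0"
  shows "abs_cont_on {c..d} (\<lambda>x. inverse (f x))"
proof -
  have "continuous_on {c..d} (\<lambda>x. inverse (f x))"
    using abs_cont_on_imp_continuous_on[OF f] nz by (intro continuous_on_inverse) auto
  then have "bounded ((\<lambda>x. inverse (f x)) ` {c..d})"
    using compact_continuous_image compact_imp_bounded compact_Icc by blast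
  then obtain B where B: "B > 0" "\<And>x. x \<in> {c..d} \<Longrightarrow> norm (inverse (f x)) \<le> B"
    by (force simp: bounded_pos)
  show ?thesis
  proof (rule abs_cont_on_dominated[OF f f, of "B * B"])
    show "B * B > 0" using B by simp
    fix s t assume st: "s \<in> {c..d}" "t \<in> {c..d}"
    have "inverse (f t) - inverse (f s) = - (inverse (f t) * (f t - f s) * inverse (f s))"
      using nz st by (simp add: inverse_diff_inverse)
    then have "norm (inverse (f t) - inverse (f s)) = norm (inverse (f t)) * norm (f t - f s) * norm (inverse (f s))"
      by (metis norm_minus_cancel norm_mult)
    also have "\<dots> \<le> B * norm (f t - f s) * B"
      using B st by (intro mult_mono) auto
    also have "\<dots> \<le> B * B * (norm (f t - f s) + norm (f t - f s))"
      using B(1) by (simp add: mult_ac)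
    finally show "norm (inverse (f t) - inverse (f s)) \<le> B * B * (norm (f t - f s) + norm (f t - f s))" .
  qed
qed

lemma abs_cont_on_divide:
  fixes f g :: "real \<Rightarrow> 'a::real_normed_field"
  assumes "abs_cont_on {c..d} f" "abs_cont_on {c..d} g" "\<And>x. x \<in> {c..d} \<Longrightarrow> g x \<noteq> 0"
  shows "abs_cont_on {c..d} (\<lambda>x. f x / g x)"
  using abs_cont_on_mult[OF assms(1) abs_cont_on_inverse[OF assms(2,3)]] by (simp add: divide_inverse)

text \<open>A sign of the derivative almost everywhere decides monotonicity only together with
  absolute continuity: the Cantor function has derivative 0 almost everywhere and still increases.
  The inequalities between quotients of solutions rest on this.\<close>

lemma abs_cont_on_antimono:
  fixes f :: "real \<Rightarrow> real"
  assumes "c \<le> d" "abs_cont_on {c..d} f" "negligible N"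
    and "\<And>x. x \<in> {c..d} - N \<Longrightarrow> \<exists>D\<le>0. (f has_vector_derivative D) (at x)"
  shows "f d \<le> f c"
proof -
  have "\<exists>D. D \<le> 0 \<and> (x \<in> {c..d} - N \<longrightarrow> (f has_vector_derivative D) (at x))" for x
    using assms(4)[of x] by (cases "x \<in> {c..d} - N") auto
  then obtain f' where f': "\<And>x. f' x \<le> 0" "\<And>x. x \<in> {c..d} - N \<Longrightarrow> (f has_vector_derivative f' x) (at x)"
    by metis
  have "(f' has_integral (f d - f c)) {c..d}"
    by (rule fundamental_theorem_of_calculus_abs_cont[OF assms(1-3)])
       (use f'(2) has_vector_derivative_at_within in blast)
  then have "f d - f c \<le> 0"
    using has_integral_le[of f' "f d - f c" "{c..d}" "\<lambda>_. 0" 0] f'(1) by simp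
  then show ?thesis by simp
qed

section \<open>The open interval and local absolute continuity\<close>

lemma open_ivl: "open (ivl a b)"
proof -
  have "ivl a b = ereal -` {a<..<b}" by (auto simp: ivl_def)
  then show ?thesis by (simp add: open_vimage continuous_on_ereal)
qed

lemma Icc_subset_ivl: "c \<in> ivl a b \<Longrightarrow> d \<in> ivl a b \<Longrightarrow> {c..d} \<subseteq> ivl a b"
  by (auto simp: ivl_def intro: less_le_trans[of a "ereal c"] le_less_trans[of _ "ereal d" b])

lemma AC_loc_continuous_on:
  assumes "AC_loc (ivl a b) f"
  shows "continuous_on (ivl a b) f"
proof (rule continuous_at_imp_continuous_on, rule ballI)
  fix x assume "x \<in> ivl a b"
  then obtain e where e: "e > 0" "cball x e \<subseteq> ivl a b"
    using open_ivl open_contains_cball by blast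
  then have "continuous_on {x-e..x+e} f"
    using assms unfolding AC_loc_def by (intro abs_cont_on_imp_continuous_on) (simp add: cball_eq_atLeastAtMost)
  then show "isCont f x"
    using e by (intro continuous_on_interior[of "{x-e..x+e}"]) (auto simp: interior_atLeastAtMost_real)
qed

section \<open>Wronskians and comparison of solutions\<close>

lemma is_solD:
  assumes "is_sol a b p q r z f g"
  shows "AC_loc (ivl a b) f" "AC_loc (ivl a b) g"
    "\<And>c d. {c..d} \<subseteq> ivl a b \<Longrightarrow> abs_cont_on {c..d} f"
    "\<And>c d. {c..d} \<subseteq> ivl a b \<Longrightarrow> abs_cont_on {c..d} g"
    "continuous_on (ivl a b) f" "continuous_on (ivl a b) g"
  using assms AC_loc_continuous_on unfolding is_sol_def AC_loc_def by blast+

lemma is_sol_negligible: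
  assumes "is_sol a b p q r z f g"
  obtains N where "negligible N"
    "\<And>x. x \<in> ivl a b - N \<Longrightarrow> \<exists>f'. (f has_vector_derivative f') (at x) \<and> of_real (p x) * f' = g x"
    "\<And>x. x \<in> ivl a b - N \<Longrightarrow> (g has_vector_derivative ((of_real (q x) - z * of_real (r x)) * f x)) (at x)"
proof -
  have "AE x in lebesgue. x \<in> ivl a b \<longrightarrow> (\<exists>f'. (f has_vector_derivative f') (at x) \<and> of_real (p x) * f' = g x)"
    "AE x in lebesgue. x \<in> ivl a b \<longrightarrow> (g has_vector_derivative ((of_real (q x) - z * of_real (r x)) * f x)) (at x)"
    using assms unfolding is_sol_def by blast+
  then have "AE x in lebesgue. x \<in> ivl a b \<longrightarrow>
        (\<exists>f'. (f has_vector_derivative f') (at x) \<and> of_real (p x) * f' = g x) \<and>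
        (g has_vector_derivative ((of_real (q x) - z * of_real (r x)) * f x)) (at x)"
    by eventually_elim blast
  then obtain N where "negligible N" "{x. \<not> (x \<in> ivl a b \<longrightarrow>
        (\<exists>f'. (f has_vector_derivative f') (at x) \<and> of_real (p x) * f' = g x) \<and>
        (g has_vector_derivative ((of_real (q x) - z * of_real (r x)) * f x)) (at x))} \<subseteq> N"
    unfolding eventually_ae_filter_negligible by blast
  then show thesis by (intro that[of N]) blast+
qed

lemma wronskian_abs_cont:
  assumes "is_sol a b p q r z1 f f1" "is_sol a b p q r z2 g g1" "{c..d} \<subseteq> ivl a b"
  shows "abs_cont_on {c..d} (\<lambda>x. f x * g1 x - f1 x * g x)"
  using assms by (intro abs_cont_on_diff abs_cont_on_mult is_solD)

text \<open>Lagrange's identity in integrated form: f' g1 and f1 g' both equal p f' g', and the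
  potential \<open>q\<close> cancels, which leaves the difference of the parameters.\<close>

lemma wronskian_has_integral:
  fixes z1 z2 :: "'a::{real_normed_field, banach}"
  assumes f: "is_sol a b p q r z1 f f1" and g: "is_sol a b p q r z2 g g1"
    and cd: "c \<le> d" "{c..d} \<subseteq> ivl a b"
  shows "((\<lambda>x. (z1 - z2) * of_real (r x) * f x * g x) has_integral
     ((f d * g1 d - f1 d * g d) - (f c * g1 c - f1 c * g c))) {c..d}"
proof -
  obtain N where N: "negligible N"
    "\<And>x. x \<in> ivl a b - N \<Longrightarrow> \<exists>f'. (f has_vector_derivative f') (at x) \<and> of_real (p x) * f' = f1 x"
    "\<And>x. x \<in> ivl a b - N \<Longrightarrow> (f1 has_vector_derivative ((of_real (q x) - z1 * of_real (r x)) * f x)) (at x)"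
    using is_sol_negligible[OF f] by blast
  obtain M where M: "negligible M"
    "\<And>x. x \<in> ivl a b - M \<Longrightarrow> \<exists>f'. (g has_vector_derivative f') (at x) \<and> of_real (p x) * f' = g1 x"
    "\<And>x. x \<in> ivl a b - M \<Longrightarrow> (g1 has_vector_derivative ((of_real (q x) - z2 * of_real (r x)) * g x)) (at x)"
    using is_sol_negligible[OF g] by blast
  show ?thesis
  proof (rule fundamental_theorem_of_calculus_abs_cont[OF cd(1) wronskian_abs_cont[OF f g cd(2)], of "N \<union> M"])
    show "negligible (N \<union> M)" using N M by simp
    fix x assume "x \<in> {c..d} - (N \<union> M)"
    then have x: "x \<in> ivl a b - N" "x \<in> ivl a b - M" using cd by auto
    obtain f' where f': "(f has_vector_derivative f') (at x)" "of_real (p x) * f' = f1 x" using N(2)[OF x(1)] by blast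
    obtain g' where g': "(g has_vector_derivative g') (at x)" "of_real (p x) * g' = g1 x" using M(2)[OF x(2)] by blast
    have "((\<lambda>x. f x * g1 x - f1 x * g x) has_vector_derivative
        (f x * ((of_real (q x) - z2 * of_real (r x)) * g x) + f' * g1 x
        - (f1 x * g' + ((of_real (q x) - z1 * of_real (r x)) * f x) * g x))) (at x)"
      by (intro has_vector_derivative_diff has_vector_derivative_mult f' g' N(3) M(3) x)
    moreover have "f x * ((of_real (q x) - z2 * of_real (r x)) * g x) + f' * g1 x
        - (f1 x * g' + ((of_real (q x) - z1 * of_real (r x)) * f x) * g x) = (z1 - z2) * of_real (r x) * f x * g x"
      by (simp add: f'(2)[symmetric] g'(2)[symmetric] algebra_simps)
    ultimately show "((\<lambda>x. f x * g1 x - f1 x * g x) has_vector_derivative ((z1 - z2) * of_real (r x) * f x * g x)) (at x within {c..d})"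
      by (simp add: has_vector_derivative_at_within)
  qed
qed

text \<open>Cramer's rule: the Wronskians of \<open>y\<close> with \<open>g\<close> and
  \<open>f\<close> are the coefficients of \<open>y\<close> in the basis \<open>f\<close>,
  \<open>g\<close>, and by Lagrange's identity they are constant.\<close>

lemma solution_bound_same_parameter:
  fixes z :: complex
  assumes y: "is_sol a b p q r z y y1" and f: "is_sol a b p q r z f f1" and g: "is_sol a b p q r z g g1"
    and W: "\<And>x. x \<in> ivl a b \<Longrightarrow> f x * g1 x - f1 x * g x = 1"
  obtains C where "C \<ge> 0" "\<And>x. x \<in> ivl a b \<Longrightarrow> cmod (y x) \<le> C * (cmod (f x) + cmod (g x))"
proof (cases "ivl a b = {}")
  case False
  then obtain c where c: "c \<in> ivl a b" by blast
  define A where "A x = y x * g1 x - y1 x * g x" for x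
  define B where "B x = f x * y1 x - f1 x * y x" for x
  have const: "F x = F c" if "\<And>s t. s \<le> t \<Longrightarrow> {s..t} \<subseteq> ivl a b \<Longrightarrow> F t = F s" "x \<in> ivl a b" for x and F :: "real \<Rightarrow> complex"
    using that(1)[of x c] that(1)[of c x] Icc_subset_ivl[OF c that(2)] Icc_subset_ivl[OF that(2) c]
    by (cases "x \<le> c") auto
  have A: "A x = A c" if "x \<in> ivl a b" for x
  proof (rule const[OF _ that])
    show "A t = A s" if "s \<le> t" "{s..t} \<subseteq> ivl a b" for s t
      using wronskian_has_integral[OF y g that] has_integral_unique[OF _ has_integral_0] by (auto simp: A_def)
  qed
  have B: "B x = B c" if "x \<in> ivl a b" for x
  proof (rule const[OF _ that])
    show "B t = B s" if "s \<le> t" "{s..t} \<subseteq> ivl a b" for s t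
      using wronskian_has_integral[OF f y that] has_integral_unique[OF _ has_integral_0] by (auto simp: B_def)
  qed
  show thesis
  proof (rule that)
    show "0 \<le> cmod (A c) + cmod (B c)" by simp
    fix x assume x: "x \<in> ivl a b"
    have "y x = y x * (f x * g1 x - f1 x * g x)" using W[OF x] by simp
    also have "\<dots> = A x * f x + B x * g x" by (simp add: A_def B_def algebra_simps)
    finally have "cmod (y x) \<le> cmod (A c) * cmod (f x) + cmod (B c) * cmod (g x)"
      using A[OF x] B[OF x] by (metis norm_mult norm_triangle_ineq)
    also have "\<dots> \<le> (cmod (A c) + cmod (B c)) * (cmod (f x) + cmod (g x))"
      by (simp add: algebra_simps)
    finally show "cmod (y x) \<le> (cmod (A c) + cmod (B c)) * (cmod (f x) + cmod (g x))" .
  qed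
qed (use that[of 0] in auto)

section \<open>Bounds for solutions across different spectral parameters\<close>

lemma integral_tail_small:
  fixes G :: "real \<Rightarrow> real"
  assumes G: "G integrable_on {x. a < ereal x \<and> x < c0}" and nonneg: "\<And>x. G x \<ge> 0"
    and c0: "c0 \<in> ivl a b" and e: "e > 0"
  obtains c where "c \<in> ivl a b" "c < c0" "\<And>x. \<lbrakk>x \<in> ivl a b; x \<le> c\<rbrakk> \<Longrightarrow> integral {x..c} G \<le> e"
proof -
  obtain c1 where c1: "c1 \<in> ivl a b" "c1 < c0"
  proof -
    obtain e where e: "e > 0" "cball c0 e \<subseteq> ivl a b" using c0 open_ivl open_contains_cball by blast
    have "c0 - e \<in> ivl a b" by (rule subsetD[OF e(2)]) (use e in \<open>simp add: dist_real_def\<close>)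
    then show thesis using that[of "c0 - e"] e by simp
  qed
  define S where "S = {x. a < ereal x \<and> x < c0}"
  have sub: "{x..c1} \<subseteq> S" if "x \<in> ivl a b" for x
    using that c1 unfolding S_def ivl_def by (auto intro: less_le_trans)
  have int: "G integrable_on {x..y}" if "x \<in> ivl a b" "y \<le> c1" for x y
  proof (rule integrable_on_subinterval[OF G])
    show "{x..y} \<subseteq> {x. a < ereal x \<and> x < c0}" using sub[OF that(1)] that(2) by (auto simp: S_def subset_eq)
  qed
  \<comment> \<open>As x decreases to a, \<open>I x\<close> increases and stays below the integral
    over the whole set. A point \<open>c\<close> at which \<open>I\<close> is within
    \<open>e\<close> of its supremum leaves at most \<open>e\<close> to its left.\<close>
  define I where "I x = integral {x..c1} G" for x
  define X where "X = I ` {x \<in> ivl a b. x \<le> c1}"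
  have bdd: "bdd_above X"
  proof (rule bdd_aboveI)
    fix y assume "y \<in> X"
    then obtain x where x: "x \<in> ivl a b" "x \<le> c1" "y = I x" unfolding X_def by auto
    show "y \<le> integral S G"
      unfolding x(3) I_def using sub[OF x(1)] int[OF x(1)] G nonneg
      by (intro integral_subset_le) (auto simp: S_def)
  qed
  have ne: "X \<noteq> {}" using c1 unfolding X_def by auto
  obtain c where c: "c \<in> ivl a b" "c \<le> c1" "I c > Sup X - e"
    using less_cSup_iff[OF ne bdd, of "Sup X - e"] e unfolding X_def by auto
  show thesis
  proof (rule that[of c])
    fix x assume x: "x \<in> ivl a b" "x \<le> c"
    have "integral {x..c} G + integral {c..c1} G = integral {x..c1} G"
      using x c int[of x c1] by (intro Henstock_Kurzweil_Integration.integral_combine) auto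
    moreover have "I x \<le> Sup X"
      using x c bdd by (intro cSup_upper) (auto simp: X_def)
    ultimately show "integral {x..c} G \<le> e" using c by (simp add: I_def)
  qed (use c c1 in auto)
qed

text \<open>
  Variation of constants \<open>y = A f + B g\<close>. Once \<open>c\<close> is so close to \<open>a\<close> that \<open>(\<bar>f\<bar> + \<bar>g\<bar>)\<^sup>2 r\<close> has small integral to the
  left of \<open>c\<close>, the maximum of \<open>\<bar>A\<bar> + \<bar>B\<bar>\<close> over \<open>[x, c]\<close> is at most twice its value at \<open>c\<close>, uniformly in \<open>x\<close>.
\<close>
lemma solution_bound_other_parameter:
  fixes z1 z2 :: complex
  assumes y: "is_sol a b p q r z1 y y1" and f: "is_sol a b p q r z2 f f1" and g: "is_sol a b p q r z2 g g1"
    and W: "\<And>x. x \<in> ivl a b \<Longrightarrow> f x * g1 x - f1 x * g x = 1" and c0: "c0 \<in> ivl a b"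
    and fint: "(\<lambda>x. (cmod (f x))\<^sup>2 * r x) absolutely_integrable_on {x. a < ereal x \<and> x < c0}"
    and gint: "(\<lambda>x. (cmod (g x))\<^sup>2 * r x) absolutely_integrable_on {x. a < ereal x \<and> x < c0}"
  obtains c C where "c \<in> ivl a b" "c < c0" "C \<ge> 0"
    "\<And>x. x \<in> ivl a b \<Longrightarrow> x \<le> c \<Longrightarrow> cmod (y x) \<le> C * (cmod (f x) + cmod (g x))"
proof -
  define K where "K = cmod (z1 - z2)"
  have K: "K \<ge> 0" unfolding K_def by simp
  define A where "A x = y x * g1 x - y1 x * g x" for x
  define B where "B x = f x * y1 x - f1 x * y x" for x
  define S where "S x = cmod (A x) + cmod (B x)" for x
  define F where "F x = cmod (f x) + cmod (g x)" for x
  have F0: "F x \<ge> 0" for x unfolding F_def by simp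
  have S0: "S x \<ge> 0" for x unfolding S_def by simp
  have ybd: "cmod (y x) \<le> S x * F x" if "x \<in> ivl a b" for x
  proof -
    have "y x = y x * (f x * g1 x - f1 x * g x)" using W[OF that] by simp
    also have "\<dots> = A x * f x + B x * g x" by (simp add: A_def B_def algebra_simps)
    finally have "cmod (y x) \<le> cmod (A x) * cmod (f x) + cmod (B x) * cmod (g x)"
      by (metis norm_mult norm_triangle_ineq)
    also have "\<dots> \<le> S x * F x"
      by (simp add: S_def F_def algebra_simps)
    finally show ?thesis .
  qed
  \<comment> \<open>The factor 2 comes from (s + t)^2 \<le> 2 (s^2 + t^2).\<close>
  define G where "G x = 2 * (norm ((cmod (f x))\<^sup>2 * r x) + norm ((cmod (g x))\<^sup>2 * r x))" for x
  have G0: "G x \<ge> 0" for x unfolding G_def by simp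
  have FG: "F x * F x * \<bar>r x\<bar> \<le> G x" for x
  proof -
    have "F x * F x \<le> 2 * ((cmod (f x))\<^sup>2 + (cmod (g x))\<^sup>2)"
      using sum_squares_bound[of "cmod (f x)" "cmod (g x)"]
      by (simp add: F_def power2_eq_square algebra_simps)
    then have "F x * F x * \<bar>r x\<bar> \<le> 2 * ((cmod (f x))\<^sup>2 + (cmod (g x))\<^sup>2) * \<bar>r x\<bar>"
      by (rule mult_right_mono) simp
    then show ?thesis by (simp add: G_def abs_mult algebra_simps)
  qed
  have Gint: "G integrable_on {x. a < ereal x \<and> x < c0}"
    unfolding G_def using fint gint unfolding absolutely_integrable_on_def
    by (intro integrable_on_mult_right integrable_add) auto
  \<comment> \<open>Chosen so that \<open>2 * K * e \<le> 1 / 2\<close>, which lets half of the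
    maximum be absorbed on the left; \<open>K + 1\<close> avoids a zero denominator when
    \<open>z1 = z2\<close>.\<close>
  define e where "e = 1 / (4 * (K + 1))"
  have e: "e > 0" "2 * K * e \<le> 1 / 2" using K unfolding e_def by (auto simp: field_simps)
  obtain c where c: "c \<in> ivl a b" "c < c0" "\<And>x. \<lbrakk>x \<in> ivl a b; x \<le> c\<rbrakk> \<Longrightarrow> integral {x..c} G \<le> e"
    using integral_tail_small[OF Gint G0 c0 e(1)] by blast
  have bound: "S x \<le> 2 * S c" if x: "x \<in> ivl a b" "x \<le> c" for x
  proof -
    have sub: "{x..c} \<subseteq> ivl a b" using Icc_subset_ivl x(1) c(1) by blast
    have "continuous_on {x..c} S"
      unfolding S_def A_def B_def
      by (intro continuous_intros; rule continuous_on_subset[OF _ sub]; intro is_solD[OF y] is_solD[OF f] is_solD[OF g])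
    then obtain s where s: "s \<in> {x..c}" "\<And>t. t \<in> {x..c} \<Longrightarrow> S t \<le> S s"
      using continuous_attains_sup[of "{x..c}" S] x(2) by auto
    have sub': "{s..c} \<subseteq> ivl a b" "s \<le> c" "s \<in> ivl a b" using sub s by auto
    have Gi: "G integrable_on {s..c}"
      by (rule integrable_on_subinterval[OF Gint])
         (use sub' c in \<open>auto simp: ivl_def subset_eq\<close>)
    \<comment> \<open>One estimate serves both coefficients: \<open>h\<close>, \<open>k\<close> are
      \<open>y\<close>, \<open>g\<close> for \<open>A\<close> and \<open>f\<close>, \<open>y\<close>
      for \<open>B\<close>.\<close>
    have step: "cmod (D s) \<le> cmod (D c) + K * S s * e"
      if hi: "((\<lambda>x. w * of_real (r x) * h x * k x) has_integral (D c - D s)) {s..c}"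
        and w: "cmod w = K"
        and h: "\<And>t. t \<in> {s..c} \<Longrightarrow> cmod (h t) * cmod (k t) \<le> S s * (F t * F t)" for D w h k
    proof -
      have "cmod (D c - D s) \<le> integral {s..c} (\<lambda>t. K * S s * G t)"
        unfolding integral_unique[OF hi, symmetric]
      proof (rule integral_norm_bound_integral)
        show "(\<lambda>t. K * S s * G t) integrable_on {s..c}" using Gi by (rule integrable_on_mult_right)
        show "(\<lambda>x. w * of_real (r x) * h x * k x) integrable_on {s..c}" using hi by blast
        fix t assume t: "t \<in> {s..c}"
        have "cmod (w * of_real (r t) * h t * k t) = K * \<bar>r t\<bar> * (cmod (h t) * cmod (k t))"
          by (simp add: norm_mult w)
        also have "\<dots> \<le> K * \<bar>r t\<bar> * (S s * (F t * F t))"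
          using h[OF t] K by (intro mult_left_mono) auto
        also have "\<dots> = K * S s * (F t * F t * \<bar>r t\<bar>)" by (simp add: algebra_simps)
        also have "\<dots> \<le> K * S s * G t" using FG K S0 by (intro mult_left_mono) auto
        finally show "cmod (w * of_real (r t) * h t * k t) \<le> K * S s * G t" .
      qed
      also have "\<dots> = K * S s * integral {s..c} G" by simp
      also have "\<dots> \<le> K * S s * e" using c(3)[OF sub'(3,2)] K S0 by (intro mult_left_mono) auto
      finally show ?thesis using norm_triangle_sub[of "D s" "D c"] by (simp add: norm_minus_commute)
    qed
    have yS: "cmod (y t) \<le> S s * F t" if "t \<in> {s..c}" for t
    proof -
      have "t \<in> ivl a b" "t \<in> {x..c}" using that sub' s by auto
      then show ?thesis using ybd[of t] s(2)[of t] F0[of t] mult_right_mono order_trans by blast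
    qed
    have "cmod (A s) \<le> cmod (A c) + K * S s * e"
    proof (rule step)
      show "((\<lambda>x. (z1 - z2) * of_real (r x) * y x * g x) has_integral (A c - A s)) {s..c}"
        unfolding A_def by (rule wronskian_has_integral[OF y g sub'(2,1)])
      fix t assume "t \<in> {s..c}"
      then have "cmod (y t) * cmod (g t) \<le> (S s * F t) * F t"
        using yS[of t] F0[of t] S0[of s] by (intro mult_mono) (auto simp: F_def)
      then show "cmod (y t) * cmod (g t) \<le> S s * (F t * F t)" by (simp add: mult.assoc)
    qed (simp add: K_def)
    moreover have "cmod (B s) \<le> cmod (B c) + K * S s * e"
    proof (rule step)
      show "((\<lambda>x. (z2 - z1) * of_real (r x) * f x * y x) has_integral (B c - B s)) {s..c}"
        unfolding B_def by (rule wronskian_has_integral[OF f y sub'(2,1)])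
      fix t assume "t \<in> {s..c}"
      then have "cmod (f t) * cmod (y t) \<le> F t * (S s * F t)"
        using yS[of t] F0[of t] S0[of s] by (intro mult_mono) (auto simp: F_def)
      then show "cmod (f t) * cmod (y t) \<le> S s * (F t * F t)" by (simp add: mult_ac)
    qed (simp add: K_def norm_minus_commute)
    ultimately have "S s \<le> S c + 2 * K * e * S s" by (simp add: S_def algebra_simps)
    also have "\<dots> \<le> S c + 1 / 2 * S s" using e(2) S0 by (intro add_left_mono mult_right_mono) auto
    finally have "S s \<le> 2 * S c" by simp
    then show ?thesis using s(2)[of x] x by auto
  qed
  show thesis
  proof (rule that[OF c(1,2), of "2 * S c"])
    fix x assume x: "x \<in> ivl a b" "x \<le> c"
    show "cmod (y x) \<le> 2 * S c * (cmod (f x) + cmod (g x))"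
      using ybd[OF x(1)] mult_right_mono[OF bound[OF x] F0[of x]] by (simp add: F_def)
  qed (use S0 in simp)
qed

section \<open>Truncated moments of a weight\<close>

text \<open>Bisecting at the point where \<open>W\<close> takes its mean value halves the bound for the total increment of \<open>D\<close>.\<close>
lemma increment_product_bound_imp_eq:
  fixes D W N :: "real \<Rightarrow> real"
  assumes xy: "x \<le> y" and cont: "continuous_on {x..y} W"
    and mono: "\<And>s t. x \<le> s \<Longrightarrow> s \<le> t \<Longrightarrow> t \<le> y \<Longrightarrow> W t \<le> W s"
    and bd: "\<And>s t. x \<le> s \<Longrightarrow> s \<le> t \<Longrightarrow> t \<le> y \<Longrightarrow> \<bar>D s - D t\<bar> \<le> K * ((W s - W t) * (N t - N s))"
  shows "D x = D y"
proof -
  have *: "\<bar>D s - D t\<bar> \<le> K * ((W s - W t) * (N t - N s)) / 2 ^ n" if "x \<le> s" "s \<le> t" "t \<le> y" for s t n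
    using that
  proof (induction n arbitrary: s t)
    case 0
    then show ?case using bd by simp
  next
    case (Suc n)
    have "continuous_on {s..t} W" using Suc.prems by (intro continuous_on_subset[OF cont]) auto
    then obtain m where m: "s \<le> m" "m \<le> t" "W m = (W s + W t) / 2"
      using IVT2'[of W t "(W s + W t) / 2" s] mono[OF Suc.prems] Suc.prems(2) by auto
    have "\<bar>D s - D m\<bar> \<le> K * ((W s - W m) * (N m - N s)) / 2 ^ n"
      "\<bar>D m - D t\<bar> \<le> K * ((W m - W t) * (N t - N m)) / 2 ^ n"
      using Suc.IH[of s m] Suc.IH[of m t] Suc.prems m(1,2) by auto
    then have "\<bar>D s - D t\<bar> \<le> K * ((W s - W m) * (N m - N s)) / 2 ^ n + K * ((W m - W t) * (N t - N m)) / 2 ^ n"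
      by linarith
    also have "\<dots> = K * ((W s - W t) * (N t - N s)) / 2 ^ Suc n"
      unfolding m(3) by (simp add: field_simps)
    finally show ?case .
  qed
  have lim: "(\<lambda>n. K * ((W x - W y) * (N y - N x)) * (1 / 2) ^ n) \<longlonglongrightarrow> K * ((W x - W y) * (N y - N x)) * 0"
    by (intro tendsto_intros LIMSEQ_power_zero) simp
  have "\<bar>D x - D y\<bar> \<le> K * ((W x - W y) * (N y - N x)) * (1 / 2) ^ n" for n
    using *[of x y n] xy by (simp add: power_one_over)
  then have "\<bar>D x - D y\<bar> \<le> 0"
    using LIMSEQ_le_const[OF lim, of "\<bar>D x - D y\<bar>"] by simp
  then show ?thesis by simp
qed

text \<open>Keeps the integral inequalities apart from the differential equation. Later
  \<open>w\<close> is W near a and \<open>\<rho>\<close> is u^2 |r|, and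
  \<open>w\<rho>_integrable\<close> is what (H_a) provides.\<close>

locale weighted_moment =
  fixes w \<rho> :: "real \<Rightarrow> real"
  assumes w_meas [measurable]: "w \<in> borel_measurable lebesgue"
    and \<rho>_meas [measurable]: "\<rho> \<in> borel_measurable lebesgue"
    and w_pos: "\<And>t. w t \<ge> 0" and \<rho>_nonneg: "\<And>t. \<rho> t \<ge> 0"
    and w\<rho>_integrable: "integrable lebesgue (\<lambda>t. w t * \<rho> t)"
begin

text \<open>For decreasing \<open>w\<close> and \<open>\<alpha> = w x\<close> the integrand lives on
  t < x, so this is the function N(x), expressed through the value of \<open>w\<close>
  alone.\<close>

definition excess :: "real \<Rightarrow> real" where
  "excess \<alpha> = (LINT t|lebesgue. (w t - min (w t) \<alpha>) * \<rho> t)"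

text \<open>Candidate for h up to a constant, with \<open>\<alpha> = w x\<close>. Capping one of the
  two factors keeps the integral finite when only w \<rho> is integrable; removing the cap gives the
  integral of w^2 \<rho>.\<close>

definition truncated :: "real \<Rightarrow> real" where
  "truncated \<alpha> = (LINT t|lebesgue. w t * min (w t) \<alpha> * \<rho> t)"

lemma excess_integrable: "\<alpha> \<ge> 0 \<Longrightarrow> integrable lebesgue (\<lambda>t. (w t - min (w t) \<alpha>) * \<rho> t)"
  by (rule Bochner_Integration.integrable_bound[OF w\<rho>_integrable])
     (use w_pos \<rho>_nonneg in \<open>auto simp: abs_mult min_def intro!: AE_I2 mult_right_mono\<close>)

lemma min_integrable: "\<alpha> \<ge> 0 \<Longrightarrow> integrable lebesgue (\<lambda>t. min (w t) \<alpha> * \<rho> t)"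
  by (rule Bochner_Integration.integrable_bound[OF w\<rho>_integrable])
     (use w_pos \<rho>_nonneg in \<open>auto simp: abs_mult intro!: AE_I2 mult_right_mono\<close>)

lemma truncated_integrable:
  assumes "\<alpha> \<ge> 0"
  shows "integrable lebesgue (\<lambda>t. w t * min (w t) \<alpha> * \<rho> t)"
proof (rule Bochner_Integration.integrable_bound)
  show "integrable lebesgue (\<lambda>t. \<alpha> * (w t * \<rho> t))" using w\<rho>_integrable by simp
  have "w t * min (w t) \<alpha> * \<rho> t \<le> w t * \<alpha> * \<rho> t" for t
    using w_pos \<rho>_nonneg by (intro mult_right_mono mult_left_mono) auto
  then show "AE t in lebesgue. norm (w t * min (w t) \<alpha> * \<rho> t) \<le> norm (\<alpha> * (w t * \<rho> t))"
    using w_pos \<rho>_nonneg assms by (auto simp: abs_mult mult_ac intro!: AE_I2)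
qed simp

lemma excess_antimono: "0 \<le> \<beta> \<Longrightarrow> \<beta> \<le> \<alpha> \<Longrightarrow> excess \<alpha> \<le> excess \<beta>"
  unfolding excess_def
  by (intro integral_mono excess_integrable mult_right_mono \<rho>_nonneg) auto

lemma truncated_mono: "0 \<le> \<beta> \<Longrightarrow> \<beta> \<le> \<alpha> \<Longrightarrow> truncated \<beta> \<le> truncated \<alpha>"
  unfolding truncated_def
  by (intro integral_mono truncated_integrable mult_right_mono mult_left_mono \<rho>_nonneg w_pos) auto

lemma excess_diff:
  assumes "0 \<le> \<beta>" "0 \<le> \<alpha>"
  shows "excess \<beta> - excess \<alpha> = (LINT t|lebesgue. (min (w t) \<alpha> - min (w t) \<beta>) * \<rho> t)"
  unfolding excess_def
  by (subst Bochner_Integration.integral_diff[symmetric])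
     (use assms excess_integrable in \<open>auto simp: algebra_simps intro!: Bochner_Integration.integral_cong\<close>)

lemma min_diff_integrable:
  assumes "0 \<le> \<beta>" "0 \<le> \<alpha>"
  shows "integrable lebesgue (\<lambda>t. (min (w t) \<alpha> - min (w t) \<beta>) * \<rho> t)"
  using Bochner_Integration.integrable_diff[OF min_integrable[OF assms(2)] min_integrable[OF assms(1)]]
  by (simp add: left_diff_distrib)

lemma truncated_diff:
  assumes "0 \<le> \<beta>" "0 \<le> \<alpha>"
  shows "truncated \<alpha> - truncated \<beta> = (LINT t|lebesgue. w t * (min (w t) \<alpha> - min (w t) \<beta>) * \<rho> t)"
    and "integrable lebesgue (\<lambda>t. w t * (min (w t) \<alpha> - min (w t) \<beta>) * \<rho> t)"
  using Bochner_Integration.integrable_diff[OF truncated_integrable[OF assms(2)] truncated_integrable[OF assms(1)]]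
    Bochner_Integration.integral_diff[OF truncated_integrable[OF assms(2)] truncated_integrable[OF assms(1)]]
  unfolding truncated_def by (simp_all add: algebra_simps)

text \<open>Integrated form of dF = N d\<alpha> - \<alpha> dN, where F is \<open>truncated\<close>
  and N is \<open>excess\<close>, with the coefficients frozen at their smaller and at their larger
  end values. The two bounds differ by 2 (\<alpha> - \<beta>) (N(\<beta>) - N(\<alpha>)), a product
  of increments. Each follows from an inequality valid pointwise in t.\<close>

lemma truncated_diff_bounds:
  assumes "0 \<le> \<beta>" "\<beta> \<le> \<alpha>"
  shows "excess \<alpha> * (\<alpha> - \<beta>) + \<beta> * (excess \<beta> - excess \<alpha>) \<le> truncated \<alpha> - truncated \<beta>"
    and "truncated \<alpha> - truncated \<beta> \<le> \<alpha> * (excess \<beta> - excess \<alpha>) + excess \<beta> * (\<alpha> - \<beta>)"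
proof -
  have \<alpha>: "0 \<le> \<alpha>" using assms by simp
  have eq1: "excess \<alpha> * (\<alpha> - \<beta>) + \<beta> * (excess \<beta> - excess \<alpha>) =
     (LINT t|lebesgue. (w t - min (w t) \<alpha>) * \<rho> t * (\<alpha> - \<beta>) + \<beta> * ((min (w t) \<alpha> - min (w t) \<beta>) * \<rho> t))"
    unfolding excess_diff[OF assms(1) \<alpha>]
    by (subst Bochner_Integration.integral_add)
       (use excess_integrable[OF \<alpha>] min_diff_integrable[OF assms(1) \<alpha>] in \<open>auto simp: excess_def\<close>)
  have eq2: "\<alpha> * (excess \<beta> - excess \<alpha>) + excess \<beta> * (\<alpha> - \<beta>) =
     (LINT t|lebesgue. \<alpha> * ((min (w t) \<alpha> - min (w t) \<beta>) * \<rho> t) + (w t - min (w t) \<beta>) * \<rho> t * (\<alpha> - \<beta>))"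
    unfolding excess_diff[OF assms(1) \<alpha>]
    by (subst Bochner_Integration.integral_add)
       (use excess_integrable[OF assms(1)] min_diff_integrable[OF assms(1) \<alpha>] in \<open>auto simp: excess_def\<close>)
  show "excess \<alpha> * (\<alpha> - \<beta>) + \<beta> * (excess \<beta> - excess \<alpha>) \<le> truncated \<alpha> - truncated \<beta>"
    unfolding eq1 truncated_diff(1)[OF assms(1) \<alpha>]
  proof (rule integral_mono)
    fix t
    have "(w t - min (w t) \<alpha>) * (\<alpha> - \<beta>) + \<beta> * (min (w t) \<alpha> - min (w t) \<beta>) \<le> w t * (min (w t) \<alpha> - min (w t) \<beta>)"
    proof (cases "w t \<ge> \<alpha>")
      case True
      have "(w t - \<alpha>) * (\<alpha> - \<beta>) + \<beta> * (\<alpha> - \<beta>) = (w t - (\<alpha> - \<beta>)) * (\<alpha> - \<beta>)" by (simp add: algebra_simps)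
      also have "\<dots> \<le> w t * (\<alpha> - \<beta>)" using assms by (intro mult_right_mono) auto
      finally show ?thesis using True assms by (simp add: min_def)
    next
      case False
      then show ?thesis using assms by (auto simp: min_def intro!: mult_right_mono)
    qed
    then have "((w t - min (w t) \<alpha>) * (\<alpha> - \<beta>) + \<beta> * (min (w t) \<alpha> - min (w t) \<beta>)) * \<rho> t
        \<le> w t * (min (w t) \<alpha> - min (w t) \<beta>) * \<rho> t"
      by (rule mult_right_mono[OF _ \<rho>_nonneg])
    then show "(w t - min (w t) \<alpha>) * \<rho> t * (\<alpha> - \<beta>) + \<beta> * ((min (w t) \<alpha> - min (w t) \<beta>) * \<rho> t)
        \<le> w t * (min (w t) \<alpha> - min (w t) \<beta>) * \<rho> t" by (simp add: algebra_simps)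
  qed (use excess_integrable[OF \<alpha>] min_diff_integrable[OF assms(1) \<alpha>] truncated_diff(2)[OF assms(1) \<alpha>] in auto)
  show "truncated \<alpha> - truncated \<beta> \<le> \<alpha> * (excess \<beta> - excess \<alpha>) + excess \<beta> * (\<alpha> - \<beta>)"
    unfolding eq2 truncated_diff(1)[OF assms(1) \<alpha>]
  proof (rule integral_mono)
    fix t
    have "w t * (min (w t) \<alpha> - min (w t) \<beta>) \<le> \<alpha> * (min (w t) \<alpha> - min (w t) \<beta>) + (w t - min (w t) \<beta>) * (\<alpha> - \<beta>)"
    proof (cases "w t \<ge> \<alpha>")
      case True
      have "w t * (\<alpha> - \<beta>) \<le> (\<alpha> + (w t - \<beta>)) * (\<alpha> - \<beta>)" using assms by (intro mult_right_mono) auto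
      then show ?thesis using True assms by (simp add: min_def algebra_simps)
    next
      case False
      have "w t * (w t - \<beta>) \<le> (\<alpha> + (\<alpha> - \<beta>)) * (w t - \<beta>)" if "w t \<ge> \<beta>"
        using assms False that by (intro mult_right_mono) auto
      then show ?thesis using assms False by (auto simp: min_def algebra_simps)
    qed
    then have "w t * (min (w t) \<alpha> - min (w t) \<beta>) * \<rho> t
      \<le> (\<alpha> * (min (w t) \<alpha> - min (w t) \<beta>) + (w t - min (w t) \<beta>) * (\<alpha> - \<beta>)) * \<rho> t"
      by (rule mult_right_mono[OF _ \<rho>_nonneg])
    then show "w t * (min (w t) \<alpha> - min (w t) \<beta>) * \<rho> t
      \<le> \<alpha> * ((min (w t) \<alpha> - min (w t) \<beta>) * \<rho> t) + (w t - min (w t) \<beta>) * \<rho> t * (\<alpha> - \<beta>)"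
      by (simp add: algebra_simps)
  qed (use excess_integrable[OF assms(1)] min_diff_integrable[OF assms(1) \<alpha>] truncated_diff(2)[OF assms(1) \<alpha>] in auto)
qed

lemma excess_nonneg: "excess \<alpha> \<ge> 0"
  unfolding excess_def by (rule Bochner_Integration.integral_nonneg) (use \<rho>_nonneg in simp)

text \<open>Monotone convergence along integer caps; at each point the truncated integrand is
  constant once n reaches w.\<close>

lemma truncated_bounded_imp_integrable:
  assumes "\<And>n::nat. truncated (real n) \<le> B"
  shows "integrable lebesgue (\<lambda>t. (w t)\<^sup>2 * \<rho> t)"
proof -
  have "incseq (\<lambda>n. truncated (real n))"
    by (intro incseq_SucI truncated_mono) auto
  then obtain L where L: "(\<lambda>n. truncated (real n)) \<longlonglongrightarrow> L"
    using incseq_convergent[of "\<lambda>n. truncated (real n)" B] assms by blast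
  show ?thesis
  proof (rule integrable_monotone_convergence[where f="\<lambda>n t. w t * min (w t) (real n) * \<rho> t" and x=L])
    show "integrable lebesgue (\<lambda>t. w t * min (w t) (real n) * \<rho> t)" for n
      by (rule truncated_integrable) simp
    show "AE t in lebesgue. mono (\<lambda>n. w t * min (w t) (real n) * \<rho> t)"
      by (intro AE_I2 monoI mult_right_mono mult_left_mono w_pos \<rho>_nonneg) auto
    show "(\<lambda>n. LINT t|lebesgue. w t * min (w t) (real n) * \<rho> t) \<longlonglongrightarrow> L"
      using L unfolding truncated_def .
    show "AE t in lebesgue. (\<lambda>n. w t * min (w t) (real n) * \<rho> t) \<longlonglongrightarrow> (w t)\<^sup>2 * \<rho> t"
    proof (rule AE_I2, rule tendsto_eventually)
      fix t
      show "\<forall>\<^sub>F n in sequentially. w t * min (w t) (real n) * \<rho> t = (w t)\<^sup>2 * \<rho> t"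
        using eventually_ge_at_top[of "nat \<lceil>w t\<rceil>"]
      proof eventually_elim
        case (elim n)
        then have "w t \<le> real n" by linarith
        then show ?case by (simp add: power2_eq_square min_def)
      qed
    qed
  qed simp
qed

lemma truncated_le:
  assumes "integrable lebesgue (\<lambda>t. (w t)\<^sup>2 * \<rho> t)" "\<alpha> \<ge> 0"
  shows "truncated \<alpha> \<le> (LINT t|lebesgue. (w t)\<^sup>2 * \<rho> t)"
  unfolding truncated_def
proof (rule integral_mono[OF truncated_integrable[OF assms(2)] assms(1)])
  fix t
  show "w t * min (w t) \<alpha> * \<rho> t \<le> (w t)\<^sup>2 * \<rho> t"
    unfolding power2_eq_square using w_pos \<rho>_nonneg by (intro mult_right_mono mult_left_mono) auto
qed

end

section \<open>Quotients of solutions\<close>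

text \<open>Coefficients and parameter are real, so real parts commute with the equation. Comparing
  quotients needs an order and hence real solutions, whereas \<open>theta\<close> and
  \<open>phi\<close> are complex valued.\<close>

lemma is_sol_Re:
  assumes "is_sol a b p q r (complex_of_real s) f g"
  shows "is_sol a b p q r s (\<lambda>x. Re (f x)) (\<lambda>x. Re (g x))"
proof -
  have deriv: "((\<lambda>x. Re (h x)) has_vector_derivative Re h') (at x)" if "(h has_vector_derivative h') (at x)" for h h' x
    using bounded_linear.has_vector_derivative[OF bounded_linear_Re that] .
  have "AC_loc (ivl a b) (\<lambda>x. Re (f x))" "AC_loc (ivl a b) (\<lambda>x. Re (g x))"
    using is_solD[OF assms] unfolding AC_loc_def by (blast intro: abs_cont_on_bounded_linear[OF bounded_linear_Re])+
  moreover have "AE x in lebesgue. x \<in> ivl a b \<longrightarrow>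
        (\<exists>f'. (f has_vector_derivative f') (at x) \<and> of_real (p x) * f' = g x)"
    "AE x in lebesgue. x \<in> ivl a b \<longrightarrow>
        (g has_vector_derivative ((of_real (q x) - complex_of_real s * of_real (r x)) * f x)) (at x)"
    using assms unfolding is_sol_def by blast+
  then have "AE x in lebesgue. x \<in> ivl a b \<longrightarrow>
        (\<exists>f'. ((\<lambda>x. Re (f x)) has_vector_derivative f') (at x) \<and> of_real (p x) * f' = Re (g x))"
    "AE x in lebesgue. x \<in> ivl a b \<longrightarrow>
        ((\<lambda>x. Re (g x)) has_vector_derivative ((of_real (q x) - s * of_real (r x)) * Re (f x))) (at x)"
  proof -
    show "AE x in lebesgue. x \<in> ivl a b \<longrightarrow>
        (\<exists>f'. ((\<lambda>x. Re (f x)) has_vector_derivative f') (at x) \<and> of_real (p x) * f' = Re (g x))"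
      if "AE x in lebesgue. x \<in> ivl a b \<longrightarrow>
        (\<exists>f'. (f has_vector_derivative f') (at x) \<and> of_real (p x) * f' = g x)"
      using that
    proof eventually_elim
      case (elim x)
      show ?case
      proof
        assume "x \<in> ivl a b"
        then obtain f' where f': "(f has_vector_derivative f') (at x)" "of_real (p x) * f' = g x" using elim by blast
        have "of_real (p x) * Re f' = Re (g x)" unfolding f'(2)[symmetric] by simp
        then show "\<exists>f'. ((\<lambda>x. Re (f x)) has_vector_derivative f') (at x) \<and> of_real (p x) * f' = Re (g x)"
          using deriv[OF f'(1)] by blast
      qed
    qed
    show "AE x in lebesgue. x \<in> ivl a b \<longrightarrow>
        ((\<lambda>x. Re (g x)) has_vector_derivative ((of_real (q x) - s * of_real (r x)) * Re (f x))) (at x)"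
      if "AE x in lebesgue. x \<in> ivl a b \<longrightarrow>
        (g has_vector_derivative ((of_real (q x) - complex_of_real s * of_real (r x)) * f x)) (at x)"
      using that
    proof eventually_elim
      case (elim x)
      show ?case using deriv[of g "(of_real (q x) - complex_of_real s * of_real (r x)) * f x" x] elim by auto
    qed
  qed
  ultimately show ?thesis unfolding is_sol_def by blast
qed

lemma SL_setting_negligible:
  assumes "SL_setting a b p q r"
  obtains N where "negligible N" "\<And>x. x \<in> ivl a b - N \<Longrightarrow> p x > 0 \<and> r x > 0"
proof -
  have "AE x in lebesgue. x \<in> ivl a b \<longrightarrow> p x > 0" "AE x in lebesgue. x \<in> ivl a b \<longrightarrow> r x > 0"
    using assms unfolding SL_setting_def by blast+
  then have "AE x in lebesgue. x \<in> ivl a b \<longrightarrow> p x > 0 \<and> r x > 0" by eventually_elim blast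
  then obtain N where "negligible N" "{x. \<not> (x \<in> ivl a b \<longrightarrow> p x > 0 \<and> r x > 0)} \<subseteq> N"
    unfolding eventually_ae_filter_negligible by blast
  then show thesis by (intro that[of N]) blast+
qed

text \<open>Multiplied by p, the numerator f' g - f g' of the quotient rule is minus the
  Wronskian.\<close>

lemma solution_quotient_derivative:
  fixes f g :: "real \<Rightarrow> real"
  assumes S: "SL_setting a b p q r" and f: "is_sol a b p q r z f f1" and g: "is_sol a b p q r z' g g1"
  obtains N where "negligible N"
    "\<And>x. \<lbrakk>x \<in> ivl a b - N; g x \<noteq> 0; f x * g1 x - f1 x * g x = 1\<rbrakk> \<Longrightarrow>
       p x > 0 \<and> ((\<lambda>x. f x / g x) has_vector_derivative (- 1 / (p x * (g x)\<^sup>2))) (at x)"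
proof -
  obtain N where N: "negligible N"
    "\<And>x. x \<in> ivl a b - N \<Longrightarrow> \<exists>f'. (f has_vector_derivative f') (at x) \<and> of_real (p x) * f' = f1 x"
    "\<And>x. x \<in> ivl a b - N \<Longrightarrow> (f1 has_vector_derivative ((of_real (q x) - z * of_real (r x)) * f x)) (at x)"
    using is_sol_negligible[OF f] by blast
  obtain M where M: "negligible M"
    "\<And>x. x \<in> ivl a b - M \<Longrightarrow> \<exists>f'. (g has_vector_derivative f') (at x) \<and> of_real (p x) * f' = g1 x"
    "\<And>x. x \<in> ivl a b - M \<Longrightarrow> (g1 has_vector_derivative ((of_real (q x) - z' * of_real (r x)) * g x)) (at x)"
    using is_sol_negligible[OF g] by blast
  obtain L where L: "negligible L" "\<And>x. x \<in> ivl a b - L \<Longrightarrow> p x > 0 \<and> r x > 0"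
    using SL_setting_negligible[OF S] by blast
  show thesis
  proof (rule that[of "N \<union> M \<union> L"])
    show "negligible (N \<union> M \<union> L)" using N M L by simp
    fix x assume x: "x \<in> ivl a b - (N \<union> M \<union> L)" and gx: "g x \<noteq> 0" and W: "f x * g1 x - f1 x * g x = 1"
    obtain f' where f': "(f has_real_derivative f') (at x)" "p x * f' = f1 x"
      using N(2)[of x] x by (auto simp: has_real_derivative_iff_has_vector_derivative)
    obtain g' where g': "(g has_real_derivative g') (at x)" "p x * g' = g1 x"
      using M(2)[of x] x by (auto simp: has_real_derivative_iff_has_vector_derivative)
    have px: "p x > 0" using L(2)[of x] x by auto
    have "((\<lambda>x. f x / g x) has_real_derivative ((f' * g x - f x * g') / (g x * g x))) (at x)"
      by (rule DERIV_divide[OF f'(1) g'(1) gx])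
    moreover have "p x * (f' * g x - f x * g') = - 1"
      using W by (simp add: f'(2)[symmetric] g'(2)[symmetric] algebra_simps)
    then have "f' * g x - f x * g' = - 1 / p x"
      using px by (metis less_irrefl nonzero_mult_div_cancel_left)
    then have "(f' * g x - f x * g') / (g x * g x) = - 1 / (p x * (g x)\<^sup>2)"
      by (simp add: power2_eq_square)
    ultimately show "p x > 0 \<and> ((\<lambda>x. f x / g x) has_vector_derivative (- 1 / (p x * (g x)\<^sup>2))) (at x)"
      using px by (simp add: has_real_derivative_iff_has_vector_derivative)
  qed
qed

text \<open>The combination A f/g - A0 f0/g0 has derivative (A0/g0^2 - A/g^2)/p almost everywhere,
  and \<open>le\<close> fixes its sign. A bound between two denominators thus passes to the
  increments of the quotients without integrating 1/(p g^2).\<close>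

lemma solution_quotient_compare:
  fixes f g f0 g0 :: "real \<Rightarrow> real"
  assumes S: "SL_setting a b p q r"
    and f: "is_sol a b p q r z f f1" and g: "is_sol a b p q r z' g g1"
    and f0: "is_sol a b p q r z0 f0 f01" and g0: "is_sol a b p q r z0' g0 g01"
    and cd: "c \<le> d" "{c..d} \<subseteq> ivl a b"
    and nz: "\<And>x. x \<in> {c..d} \<Longrightarrow> g x \<noteq> 0" "\<And>x. x \<in> {c..d} \<Longrightarrow> g0 x \<noteq> 0"
    and W: "\<And>x. x \<in> {c..d} \<Longrightarrow> f x * g1 x - f1 x * g x = 1"
           "\<And>x. x \<in> {c..d} \<Longrightarrow> f0 x * g01 x - f01 x * g0 x = 1"
    and le: "\<And>x. x \<in> {c..d} \<Longrightarrow> A0 / (g0 x)\<^sup>2 \<le> A / (g x)\<^sup>2"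
  shows "A0 * (f0 c / g0 c - f0 d / g0 d) \<le> A * (f c / g c - f d / g d)"
proof -
  obtain N where N: "negligible N"
    "\<And>x. \<lbrakk>x \<in> ivl a b - N; g x \<noteq> 0; f x * g1 x - f1 x * g x = 1\<rbrakk> \<Longrightarrow>
       p x > 0 \<and> ((\<lambda>x. f x / g x) has_vector_derivative (- 1 / (p x * (g x)\<^sup>2))) (at x)"
    using solution_quotient_derivative[OF S f g] by blast
  obtain M where M: "negligible M"
    "\<And>x. \<lbrakk>x \<in> ivl a b - M; g0 x \<noteq> 0; f0 x * g01 x - f01 x * g0 x = 1\<rbrakk> \<Longrightarrow>
       p x > 0 \<and> ((\<lambda>x. f0 x / g0 x) has_vector_derivative (- 1 / (p x * (g0 x)\<^sup>2))) (at x)"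
    using solution_quotient_derivative[OF S f0 g0] by blast
  have "A * (f d / g d) - A0 * (f0 d / g0 d) \<le> A * (f c / g c) - A0 * (f0 c / g0 c)"
  proof (rule abs_cont_on_antimono[OF cd(1), of _ "N \<union> M"])
    have "abs_cont_on {c..d} (\<lambda>x. f x / g x)" "abs_cont_on {c..d} (\<lambda>x. f0 x / g0 x)"
      using abs_cont_on_divide[OF is_solD(3)[OF f cd(2)] is_solD(3)[OF g cd(2)] nz(1)]
        abs_cont_on_divide[OF is_solD(3)[OF f0 cd(2)] is_solD(3)[OF g0 cd(2)] nz(2)] by auto
    then show "abs_cont_on {c..d} (\<lambda>x. A * (f x / g x) - A0 * (f0 x / g0 x))"
      by (intro abs_cont_on_diff abs_cont_on_bounded_linear[OF bounded_linear_mult_right])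
    show "negligible (N \<union> M)" using N M by simp
    fix x assume x: "x \<in> {c..d} - (N \<union> M)"
    then have 1: "p x > 0" "((\<lambda>x. f x / g x) has_vector_derivative (- 1 / (p x * (g x)\<^sup>2))) (at x)"
      "((\<lambda>x. f0 x / g0 x) has_vector_derivative (- 1 / (p x * (g0 x)\<^sup>2))) (at x)"
      using N(2)[of x] M(2)[of x] nz[of x] W[of x] cd by auto
    have "((\<lambda>x. A * (f x / g x) - A0 * (f0 x / g0 x)) has_vector_derivative
        (A * (- 1 / (p x * (g x)\<^sup>2)) - A0 * (- 1 / (p x * (g0 x)\<^sup>2)))) (at x)"
      using 1 by (intro has_vector_derivative_diff has_vector_derivative_mult_right) auto
    moreover have "A * (- 1 / (p x * (g x)\<^sup>2)) - A0 * (- 1 / (p x * (g0 x)\<^sup>2)) = (A0 / (g0 x)\<^sup>2 - A / (g x)\<^sup>2) / p x"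
      using 1 by (simp add: diff_divide_distrib mult.commute)
    moreover have "(A0 / (g0 x)\<^sup>2 - A / (g x)\<^sup>2) / p x \<le> 0"
      using le[of x] x 1 by (intro divide_nonpos_pos) auto
    ultimately show "\<exists>D\<le>0. ((\<lambda>x. A * (f x / g x) - A0 * (f0 x / g0 x)) has_vector_derivative D) (at x)"
      by metis
  qed
  then show ?thesis by (simp add: algebra_simps)
qed

text \<open>A negligible set cannot fill an open interval, so the derivative exists and is negative
  at some interior point. The strict drop to the right of that point survives by monotonicity on
  both sides.\<close>

lemma solution_quotient_strict_decreasing:
  fixes f g :: "real \<Rightarrow> real"
  assumes S: "SL_setting a b p q r"
    and f: "is_sol a b p q r z f f1" and g: "is_sol a b p q r z' g g1"
    and cd: "c < d" "{c..d} \<subseteq> ivl a b"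
    and nz: "\<And>x. x \<in> {c..d} \<Longrightarrow> g x \<noteq> 0"
    and W: "\<And>x. x \<in> {c..d} \<Longrightarrow> f x * g1 x - f1 x * g x = 1"
  shows "f d / g d < f c / g c"
proof -
  obtain N where N: "negligible N"
    "\<And>x. \<lbrakk>x \<in> ivl a b - N; g x \<noteq> 0; f x * g1 x - f1 x * g x = 1\<rbrakk> \<Longrightarrow>
       p x > 0 \<and> ((\<lambda>x. f x / g x) has_vector_derivative (- 1 / (p x * (g x)\<^sup>2))) (at x)"
    using solution_quotient_derivative[OF S f g] by blast
  have mono: "f t / g t \<le> f s / g s" if "c \<le> s" "s \<le> t" "t \<le> d" for s t
  proof -
    have "{s..t} \<subseteq> ivl a b" using that cd by (auto simp: subset_eq)
    then show ?thesis
      \<comment> \<open>\<open>A0 = 0\<close> and \<open>A = 1\<close> turn the comparison into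
        plain monotonicity of f/g.\<close>
      using solution_quotient_compare[OF S f g f g, of s t 0 1] that nz W by auto
  qed
  have "\<not> {c<..<d} \<subseteq> N"
    using N(1) cd(1) negligible_subset[OF N(1)] open_not_negligible[of "{c<..<d}"] by auto
  then obtain x where "x \<in> {c<..<d}" "x \<notin> N" by blast
  then have x: "c < x" "x < d" "x \<notin> N" by auto
  then have "x \<in> {c..d}" by auto
  then have "x \<in> ivl a b" using cd by blast
  have "p x > 0" "((\<lambda>x. f x / g x) has_real_derivative (- 1 / (p x * (g x)\<^sup>2))) (at x)"
    using N(2)[of x] nz[of x] W[of x] x \<open>x \<in> ivl a b\<close> by (auto simp: has_real_derivative_iff_has_vector_derivative)
  then obtain e where e: "e > 0" "\<And>h. h > 0 \<Longrightarrow> h < e \<Longrightarrow> f (x + h) / g (x + h) < f x / g x"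
    using has_real_derivative_neg_dec_right[of "\<lambda>x. f x / g x" "- 1 / (p x * (g x)\<^sup>2)" x UNIV] nz[OF \<open>x \<in> {c..d}\<close>]
    by auto
  define h where "h = min (e / 2) (d - x)"
  have "f d / g d \<le> f (x + h) / g (x + h)" using x e by (intro mono) (auto simp: h_def)
  also have "\<dots> < f x / g x" using e x by (intro e(2)) (auto simp: h_def)
  also have "\<dots> \<le> f c / g c" using x by (intro mono) auto
  finally show ?thesis .
qed

section \<open>The filter at the left endpoint, finite or infinite\<close>

lemma eventually_at_left_end:
  assumes "a < b"
  shows "eventually P (at_left_end a) \<longleftrightarrow> (\<exists>c\<in>ivl a b. \<forall>x. a < ereal x \<and> x < c \<longrightarrow> P x)"
proof (cases a)
  case (real \<alpha>)
  obtain \<beta> where \<beta>: "a < ereal \<beta>" "ereal \<beta> < b" using ereal_dense2[OF assms] by blast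
  have "eventually P (at_right \<alpha>) \<longleftrightarrow> (\<exists>c>\<alpha>. \<forall>x>\<alpha>. x < c \<longrightarrow> P x)"
    by (rule eventually_at_right_field)
  also have "\<dots> \<longleftrightarrow> (\<exists>c\<in>ivl a b. \<forall>x. a < ereal x \<and> x < c \<longrightarrow> P x)"
  proof
    assume "\<exists>c>\<alpha>. \<forall>x>\<alpha>. x < c \<longrightarrow> P x"
    then obtain c where c: "c > \<alpha>" "\<forall>x>\<alpha>. x < c \<longrightarrow> P x" by blast
    \<comment> \<open>Capping at \<beta> keeps the witness below b.\<close>
    have "min c \<beta> \<in> ivl a b" using c \<beta> real
      by (auto simp: ivl_def min_def intro: le_less_trans[of "ereal c" "ereal \<beta>" b])
    then show "\<exists>c\<in>ivl a b. \<forall>x. a < ereal x \<and> x < c \<longrightarrow> P x"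
      using c real by (intro bexI[of _ "min c \<beta>"]) auto
  qed (use real in \<open>auto simp: ivl_def\<close>)
  finally show ?thesis using real by (simp add: at_left_end_def)
next
  case MInf
  obtain \<beta> where \<beta>: "a < ereal \<beta>" "ereal \<beta> < b" using ereal_dense2[OF assms] by blast
  have "eventually P at_bot \<longleftrightarrow> (\<exists>c. \<forall>x<c. P x)"
    by (rule eventually_at_bot_dense)
  also have "\<dots> \<longleftrightarrow> (\<exists>c\<in>ivl a b. \<forall>x. a < ereal x \<and> x < c \<longrightarrow> P x)"
  proof
    assume "\<exists>c. \<forall>x<c. P x"
    then obtain c where c: "\<forall>x<c. P x" by blast
    have "min c \<beta> \<in> ivl a b" using \<beta> MInf
      by (auto simp: ivl_def min_def intro: le_less_trans[of "ereal c" "ereal \<beta>" b])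
    then show "\<exists>c\<in>ivl a b. \<forall>x. a < ereal x \<and> x < c \<longrightarrow> P x"
      using c by (intro bexI[of _ "min c \<beta>"]) auto
  qed (use MInf in \<open>auto simp: ivl_def\<close>)
  finally show ?thesis using MInf by (simp add: at_left_end_def)
qed (use assms in auto)

lemma at_left_end_neq_bot: "a < b \<Longrightarrow> at_left_end a \<noteq> bot"
  by (auto simp: at_left_end_def trivial_limit_at_right_real)

section \<open>Behaviour of the solutions near the endpoint\<close>

locale regularization_setting =
  fixes a b :: ereal and p q r :: "real \<Rightarrow> real"
    and lam :: real and u v gu gv :: "real \<Rightarrow> real" and c :: real
    and theta :: "complex \<Rightarrow> real \<Rightarrow> complex"
  assumes setting: "SL_setting a b p q r"
    and nonosc: "nonosc_at_a a b p q r lam"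
    and u_princ: "principal_at_a a b p q r lam u"
    and u_sol: "is_sol a b p q r lam u gu"
    and v_sol: "is_sol a b p q r lam v gv"
    and wronski: "\<forall>x\<in>ivl a b. v x * gu x - gv x * u x = 1"
    and c_in: "c \<in> ivl a b"
    and Ha_int: "(\<lambda>x. u x * v x * r x) absolutely_integrable_on {x. a < ereal x \<and> x < c}"
    and theta_entire: "\<forall>x\<in>ivl a b. (\<lambda>z. theta z x) holomorphic_on UNIV"
    and theta_real: "\<forall>t::real. \<forall>x\<in>ivl a b. theta (complex_of_real t) x \<in> \<real>"
    and theta_sol: "\<forall>z. \<exists>g\<theta> g\<phi>. is_sol a b p q r z (theta z) g\<theta> \<and>
                      is_sol a b p q r z (phi a r u v lam z) g\<phi> \<and>
                      (\<forall>x\<in>ivl a b. theta z x * g\<phi> x - g\<theta> x * phi a r u v lam z x = 1)"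
begin

abbreviation T :: "real \<Rightarrow> real \<Rightarrow> real" where
  "T s x \<equiv> Re (theta (complex_of_real s) x)"

abbreviation P :: "real \<Rightarrow> real \<Rightarrow> real" where
  "P s x \<equiv> Re (phi a r u v lam (complex_of_real s) x)"

lemma a_less_b: "a < b"
  using setting unfolding SL_setting_def by blast

lemma ivl_Int: "x \<in> ivl a b \<Longrightarrow> a < ereal t \<Longrightarrow> t \<le> x \<Longrightarrow> t \<in> ivl a b"
  by (auto simp: ivl_def intro: le_less_trans[of _ "ereal x"])

text \<open>The real part of the Wronskian identity splits into real parts once both
  \<open>theta\<close> and \<open>phi\<close> are real at x. For \<open>theta\<close> this is given.
  For \<open>phi\<close> it stays a premise, since an infinite sum says nothing until its
  convergence is known; \<open>phi_real\<close> discharges it near a for s near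
  \<open>lam\<close>.\<close>

lemma real_solutions:
  obtains g1 g2 where "is_sol a b p q r s (T s) g1" "is_sol a b p q r s (P s) g2"
    "\<And>x. x \<in> ivl a b \<Longrightarrow> Im (phi a r u v lam (complex_of_real s) x) = 0 \<Longrightarrow> T s x * g2 x - g1 x * P s x = 1"
proof -
  obtain G1 G2 where G: "is_sol a b p q r (complex_of_real s) (theta (complex_of_real s)) G1"
    "is_sol a b p q r (complex_of_real s) (phi a r u v lam (complex_of_real s)) G2"
    "\<And>x. x \<in> ivl a b \<Longrightarrow> theta (complex_of_real s) x * G2 x - G1 x * phi a r u v lam (complex_of_real s) x = 1"
    using theta_sol by blast
  show thesis
  proof (rule that[OF is_sol_Re[OF G(1)] is_sol_Re[OF G(2)]])
    fix x assume x: "x \<in> ivl a b" and im: "Im (phi a r u v lam (complex_of_real s) x) = 0"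
    have "Im (theta (complex_of_real s) x) = 0" using theta_real x complex_is_Real_iff by blast
    then show "T s x * Re (G2 x) - Re (G1 x) * P s x = 1"
      using arg_cong[OF G(3)[OF x], of Re] im by simp
  qed
qed

lemma phi_lam: "phi a r u v lam (complex_of_real lam) x = complex_of_real (u x)"
  unfolding phi_def by (simp add: powser_zero)

lemma base_solutions:
  obtains g1 g2 where "is_sol a b p q r lam (T lam) g1" "is_sol a b p q r lam u g2"
    "\<And>x. x \<in> ivl a b \<Longrightarrow> T lam x * g2 x - g1 x * u x = 1"
  using real_solutions[of lam] unfolding phi_lam by auto

definition W0 :: "real \<Rightarrow> real" where "W0 x = T lam x / u x"

lemma W0_strict_decreasing:
  assumes "x < y" "x \<in> ivl a b" "y \<in> ivl a b" "\<And>t. t \<in> {x..y} \<Longrightarrow> u t \<noteq> 0"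
  shows "W0 y < W0 x"
proof -
  obtain g1 g2 where g: "is_sol a b p q r lam (T lam) g1" "is_sol a b p q r lam u g2"
    "\<And>x. x \<in> ivl a b \<Longrightarrow> T lam x * g2 x - g1 x * u x = 1" using base_solutions by blast
  show ?thesis unfolding W0_def
    by (rule solution_quotient_strict_decreasing[OF setting g(1,2) assms(1)])
       (use assms g(3) Icc_subset_ivl[of x a b y] in auto)
qed

lemma solution_eventually_nonzero:
  assumes "is_sol a b p q r lam f g" "x \<in> ivl a b" "f x \<noteq> 0"
  shows "\<forall>\<^sub>F x in at_left_end a. f x \<noteq> 0"
proof -
  obtain c' where c': "c' \<in> ivl a b" "finite {x. a < ereal x \<and> x < c' \<and> f x = 0}"
    using nonosc assms unfolding nonosc_at_a_def by blast
  define Z where "Z = {x. a < ereal x \<and> x < c' \<and> f x = 0}"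
  show ?thesis
  proof (cases "Z = {}")
    case True
    then show ?thesis unfolding eventually_at_left_end[OF a_less_b] using c'(1) by (auto simp: Z_def)
  next
    case False
    have fin: "finite Z" using c' by (simp add: Z_def)
    have m: "Min Z \<in> Z" using Min_in[OF fin False] .
    have "Min Z \<in> ivl a b" using m c'(1) ivl_Int[of c' "Min Z"] by (auto simp: Z_def)
    moreover have "f x \<noteq> 0" if "a < ereal x" "x < Min Z" for x
    proof
      assume "f x = 0"
      then have "x \<in> Z" using that m by (auto simp: Z_def)
      then show False using Min_le[OF fin] that(2) by fastforce
    qed
    ultimately show ?thesis unfolding eventually_at_left_end[OF a_less_b] by blast
  qed
qed

lemma u_eventually_nonzero: "\<forall>\<^sub>F x in at_left_end a. u x \<noteq> 0"
  using u_princ u_sol solution_eventually_nonzero unfolding principal_at_a_def by blast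

lemma region_u_nonzero:
  obtains c1 where "c1 \<in> ivl a b" "\<And>x t. a < ereal x \<Longrightarrow> x \<le> t \<Longrightarrow> t \<le> c1 \<Longrightarrow> u t \<noteq> 0"
proof -
  obtain c2 where c2: "c2 \<in> ivl a b" "\<And>x. a < ereal x \<Longrightarrow> x < c2 \<Longrightarrow> u x \<noteq> 0"
    using u_eventually_nonzero unfolding eventually_at_left_end[OF a_less_b] by blast
  obtain c1 where c1: "a < ereal c1" "c1 < c2"
    using ereal_dense2[of a "ereal c2"] c2(1) by (auto simp: ivl_def)
  show thesis
  proof (rule that[of c1])
    show "c1 \<in> ivl a b" using c1 c2 ivl_Int[of c2 c1] by auto
    show "u t \<noteq> 0" if "a < ereal x" "x \<le> t" "t \<le> c1" for x t
      using c2(2)[of t] c1 that less_le_trans[of a "ereal x" "ereal t"] by simp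
  qed
qed

lemma smaller_point: "x \<in> ivl a b \<Longrightarrow> \<exists>y\<in>ivl a b. y < x"
  using ereal_dense2[of a "ereal x"] ivl_Int[of x] by (fastforce simp: ivl_def)

text \<open>A constant quotient contradicts the strict decrease of W. This makes the defining
  property of the principal solution applicable to theta_0.\<close>

lemma T_lam_not_multiple: "\<not> (\<exists>k. \<forall>x\<in>ivl a b. T lam x = k * u x)"
proof
  assume "\<exists>k. \<forall>x\<in>ivl a b. T lam x = k * u x"
  then obtain k where k: "\<And>x. x \<in> ivl a b \<Longrightarrow> T lam x = k * u x" by blast
  obtain c1 where c1: "c1 \<in> ivl a b" "\<And>x t. a < ereal x \<Longrightarrow> x \<le> t \<Longrightarrow> t \<le> c1 \<Longrightarrow> u t \<noteq> 0" using region_u_nonzero by blast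
  obtain x where x: "x \<in> ivl a b" "x < c1" using smaller_point[OF c1(1)] by blast
  have "W0 c1 < W0 x"
    by (rule W0_strict_decreasing) (use x c1 in \<open>auto simp: ivl_def\<close>)
  moreover have "W0 x = k" "W0 c1 = k" using k[OF x(1)] k[OF c1(1)] c1(2)[of x x] c1(2)[of c1 c1] x c1(1) by (auto simp: W0_def ivl_def)
  ultimately show False by simp
qed

lemma u_over_T_lam: "((\<lambda>x. u x / T lam x) \<longlongrightarrow> 0) (at_left_end a)"
proof -
  obtain g1 g2 where "is_sol a b p q r lam (T lam) g1" using base_solutions by blast
  then show ?thesis
    using u_princ T_lam_not_multiple unfolding principal_at_a_def by blast
qed

lemma T_lam_eventually_nonzero: "\<forall>\<^sub>F x in at_left_end a. T lam x \<noteq> 0"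
proof -
  obtain g1 g2 where g: "is_sol a b p q r lam (T lam) g1" using base_solutions by blast
  have "\<exists>x\<in>ivl a b. T lam x \<noteq> 0" using T_lam_not_multiple by (metis mult_zero_left)
  then show ?thesis using solution_eventually_nonzero[OF g] by blast
qed

text \<open>Principality of \<open>u\<close> gives only |W| -> infinity. Since W decreases, it stays
  above W(c1) to the left of c1, which decides the sign.\<close>

lemma W0_at_top: "filterlim W0 at_top (at_left_end a)"
  unfolding filterlim_at_top
proof
  fix B :: real
  obtain c1 where c1: "c1 \<in> ivl a b" "\<And>x t. a < ereal x \<Longrightarrow> x \<le> t \<Longrightarrow> t \<le> c1 \<Longrightarrow> u t \<noteq> 0" using region_u_nonzero by blast
  \<comment> \<open>A number of modulus above \<open>M\<close> is either above \<open>B\<close> or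
    below \<open>W0 c1\<close>.\<close>
  define M where "M = \<bar>B\<bar> + \<bar>W0 c1\<bar> + 1"
  have M: "M > 0" unfolding M_def by linarith
  have "\<forall>\<^sub>F x in at_left_end a. \<bar>u x / T lam x\<bar> < 1 / M"
    using tendstoD[OF u_over_T_lam, of "1 / M"] M by (simp add: dist_real_def)
  moreover have "\<forall>\<^sub>F x in at_left_end a. a < ereal x \<and> x < c1"
    unfolding eventually_at_left_end[OF a_less_b] using c1(1) by blast
  ultimately show "\<forall>\<^sub>F x in at_left_end a. B \<le> W0 x"
    using T_lam_eventually_nonzero
  proof eventually_elim
    case (elim x)
    have ux: "u x \<noteq> 0" using elim c1 by auto
    have x: "x \<in> ivl a b" using elim c1(1) ivl_Int[of c1 x] by auto
    have "W0 c1 < W0 x"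
      by (rule W0_strict_decreasing) (use x elim c1 in auto)
    moreover have "M < \<bar>W0 x\<bar>"
      using elim ux M unfolding W0_def by (simp add: field_simps)
    ultimately show ?case unfolding M_def by linarith
  qed
qed

text \<open>\<open>v\<close> and theta_0 both have Wronskian 1 with \<open>u\<close>, so v/u and W
  have the same derivative; comparing them in both directions with constants 1 shows that they
  differ by a constant. This carries (H_a) over from \<open>v\<close> to theta_0.\<close>

lemma v_quotient:
  obtains k where "\<forall>\<^sub>F x in at_left_end a. v x / u x = W0 x + k"
proof -
  obtain c1 where c1: "c1 \<in> ivl a b" "\<And>x t. a < ereal x \<Longrightarrow> x \<le> t \<Longrightarrow> t \<le> c1 \<Longrightarrow> u t \<noteq> 0" using region_u_nonzero by blast
  obtain g1 g2 where g: "is_sol a b p q r lam (T lam) g1" "is_sol a b p q r lam u g2"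
    "\<And>x. x \<in> ivl a b \<Longrightarrow> T lam x * g2 x - g1 x * u x = 1" using base_solutions by blast
  have eq: "v x / u x = W0 x + (v c1 / u c1 - W0 c1)" if "a < ereal x" "x < c1" for x
  proof -
    have x: "x \<in> ivl a b" using that c1(1) ivl_Int[of c1 x] by auto
    have sub: "x \<le> c1" "{x..c1} \<subseteq> ivl a b" using Icc_subset_ivl[OF x c1(1)] that by auto
    have nz: "u t \<noteq> 0" if "t \<in> {x..c1}" for t using that c1(2)[OF \<open>a < ereal x\<close>] by auto
    have "1 * (T lam x / u x - T lam c1 / u c1) \<le> 1 * (v x / u x - v c1 / u c1)"
      by (rule solution_quotient_compare[OF setting v_sol u_sol g(1,2) sub nz nz])
         (use wronski g(3) sub in auto)
    moreover have "1 * (v x / u x - v c1 / u c1) \<le> 1 * (T lam x / u x - T lam c1 / u c1)"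
      by (rule solution_quotient_compare[OF setting g(1,2) v_sol u_sol sub nz nz])
         (use wronski g(3) sub in auto)
    ultimately show ?thesis by (simp add: W0_def)
  qed
  show thesis
    by (rule that[of "v c1 / u c1 - W0 c1"]) (use eq c1(1) in \<open>auto simp: eventually_at_left_end[OF a_less_b]\<close>)
qed

text \<open>W \<ge> 1 yields |u| \<le> |theta_0|, while W \<ge> 2|k| yields W \<le> 2 |v/u|. The
  bound \<open>y0 \<le> c\<close> keeps the region inside the interval of (H_a).\<close>

lemma region:
  obtains y0 k where "y0 \<in> ivl a b" "y0 \<le> c"
    "\<And>x. a < ereal x \<Longrightarrow> x < y0 \<Longrightarrow> u x \<noteq> 0 \<and> W0 x \<ge> 1 \<and> W0 x \<ge> 2 * \<bar>k\<bar> \<and> v x / u x = W0 x + k"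
proof -
  obtain k where k: "\<forall>\<^sub>F x in at_left_end a. v x / u x = W0 x + k" using v_quotient by blast
  have "\<forall>\<^sub>F x in at_left_end a. W0 x \<ge> max 1 (2 * \<bar>k\<bar>)"
    using W0_at_top unfolding filterlim_at_top by blast
  with k u_eventually_nonzero
  have "\<forall>\<^sub>F x in at_left_end a. u x \<noteq> 0 \<and> W0 x \<ge> 1 \<and> W0 x \<ge> 2 * \<bar>k\<bar> \<and> v x / u x = W0 x + k"
    by eventually_elim simp
  then obtain y where y: "y \<in> ivl a b" "\<And>x. a < ereal x \<Longrightarrow> x < y \<Longrightarrow> u x \<noteq> 0 \<and> W0 x \<ge> 1 \<and> W0 x \<ge> 2 * \<bar>k\<bar> \<and> v x / u x = W0 x + k"
    unfolding eventually_at_left_end[OF a_less_b] by blast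
  show thesis
  proof (rule that[of "min y c" k])
    show "min y c \<in> ivl a b" using y c_in by (simp add: min_def)
  qed (use y in auto)
qed

end

section \<open>Estimates for \<open>phi\<close> close to the left endpoint\<close>

locale regularization_near_endpoint = regularization_setting +
  fixes y0 k :: real
  assumes y0: "y0 \<in> ivl a b" "y0 \<le> c"
    and near: "\<And>x. a < ereal x \<Longrightarrow> x < y0 \<Longrightarrow> u x \<noteq> 0 \<and> W0 x \<ge> 1 \<and> W0 x \<ge> 2 * \<bar>k\<bar> \<and> v x / u x = W0 x + k"
begin

definition X :: "real set" where "X = {x. a < ereal x \<and> x < y0}"

text \<open>The value 1 outside \<open>X\<close> makes w \<ge> 1 hold on the whole line; it is
  harmless in the integrals because \<open>\<rho>\<close> vanishes there.\<close>

definition w :: "real \<Rightarrow> real" where "w t = (if t \<in> X then W0 t else 1)"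

definition \<rho> :: "real \<Rightarrow> real" where "\<rho> t = (if t \<in> X then (u t)\<^sup>2 * \<bar>r t\<bar> else 0)"

lemma X_sub: "X \<subseteq> ivl a b"
  using y0 ivl_Int[of y0] by (auto simp: X_def)

lemma X_eq: "X = ivl a (ereal y0)"
  by (auto simp: X_def ivl_def)

lemma X_lebesgue: "X \<in> sets lebesgue"
  unfolding X_eq by (simp add: open_ivl borel_open)

lemma X_Icc: "x \<in> X \<Longrightarrow> y \<in> X \<Longrightarrow> {x..y} \<subseteq> X"
  unfolding X_eq by (rule Icc_subset_ivl)

lemma u_nz: "x \<in> X \<Longrightarrow> u x \<noteq> 0" and W0_ge1: "x \<in> X \<Longrightarrow> W0 x \<ge> 1"
  and W0_ge_k: "x \<in> X \<Longrightarrow> W0 x \<ge> 2 * \<bar>k\<bar>"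
  using near by (auto simp: X_def)

lemma v_eq: "x \<in> X \<Longrightarrow> v x = u x * (W0 x + k)"
  using near[of x] by (auto simp: X_def divide_eq_eq mult.commute)

lemma w_strict: "x \<in> X \<Longrightarrow> y \<in> X \<Longrightarrow> x < y \<Longrightarrow> w y < w x"
  using W0_strict_decreasing[of x y] X_sub X_Icc[of x y] u_nz by (auto simp: w_def subset_eq)

lemma w_antimono: "x \<in> X \<Longrightarrow> y \<in> X \<Longrightarrow> x \<le> y \<Longrightarrow> w y \<le> w x"
  using w_strict[of x y] by (cases "x = y") auto

lemma w_ge1: "w t \<ge> 1"
  using W0_ge1 by (auto simp: w_def)

lemma T_lam_continuous: "continuous_on (ivl a b) (T lam)"
proof -
  obtain g1 g2 where "is_sol a b p q r lam (T lam) g1" using base_solutions by blast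
  then show ?thesis by (rule is_solD)
qed

lemma W0_continuous: "continuous_on X W0"
  unfolding W0_def using u_nz
  by (intro continuous_on_divide continuous_on_subset[OF T_lam_continuous X_sub]
      continuous_on_subset[OF is_solD(5)[OF u_sol] X_sub]) auto

lemma w_continuous: "continuous_on X w"
  using W0_continuous by (rule continuous_on_eq) (simp add: w_def)

lemma measurable_extend: "f \<in> borel_measurable (lebesgue_on X) \<Longrightarrow> (\<lambda>t. if t \<in> X then f t else (0::real)) \<in> borel_measurable lebesgue"
  using borel_measurable_if[OF X_lebesgue] by blast

lemma u_meas: "u \<in> borel_measurable (lebesgue_on X)"
  by (rule continuous_imp_measurable_on_sets_lebesgue[OF continuous_on_subset[OF is_solD(5)[OF u_sol] X_sub] X_lebesgue])

lemma r_meas: "r \<in> borel_measurable (lebesgue_on X)"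
  using setting measurable_restrict_mono[OF _ X_sub] unfolding SL_setting_def by blast

lemma w_measurable: "w \<in> borel_measurable lebesgue"
proof -
  \<comment> \<open>Extension by zero fits W - 1, because \<open>w\<close> is 1 off
    \<open>X\<close>.\<close>
  have "(\<lambda>t. W0 t - 1) \<in> borel_measurable (lebesgue_on X)"
    by (intro borel_measurable_diff continuous_imp_measurable_on_sets_lebesgue[OF W0_continuous X_lebesgue]) auto
  from measurable_extend[OF this]
  have "(\<lambda>t. 1 + (if t \<in> X then W0 t - 1 else 0)) \<in> borel_measurable lebesgue" by simp
  moreover have "w = (\<lambda>t. 1 + (if t \<in> X then W0 t - 1 else 0))" by (auto simp: w_def)
  ultimately show ?thesis by simp
qed

lemma \<rho>_measurable: "\<rho> \<in> borel_measurable lebesgue"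
  unfolding \<rho>_def by (rule measurable_extend) (use u_meas r_meas in measurable)

text \<open>Hypothesis (H_a) in disguise: |u v r| = |W + k| u^2 |r|, and |W + k| \<ge> W/2 by the
  choice of the region.\<close>

lemma w\<rho>_int: "integrable lebesgue (\<lambda>t. w t * \<rho> t)"
proof (rule Bochner_Integration.integrable_bound)
  show "integrable lebesgue (\<lambda>t. 2 * (indicat_real {x. a < ereal x \<and> x < c} t *\<^sub>R (u t * v t * r t)))"
    using Ha_int unfolding set_integrable_def by simp
  show "(\<lambda>t. w t * \<rho> t) \<in> borel_measurable lebesgue"
    using w_measurable \<rho>_measurable by simp
  show "AE t in lebesgue. norm (w t * \<rho> t) \<le> norm (2 * (indicat_real {x. a < ereal x \<and> x < c} t *\<^sub>R (u t * v t * r t)))"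
  proof (rule AE_I2)
    fix t
    show "norm (w t * \<rho> t) \<le> norm (2 * (indicat_real {x. a < ereal x \<and> x < c} t *\<^sub>R (u t * v t * r t)))"
    proof (cases "t \<in> X")
      case True
      then have ind: "indicat_real {x. a < ereal x \<and> x < c} t = 1" using y0 by (auto simp: X_def)
      have "W0 t \<le> 2 * \<bar>W0 t + k\<bar>" using W0_ge_k[OF True] W0_ge1[OF True] by (simp add: abs_if split: if_splits)
      then have "W0 t * ((u t)\<^sup>2 * \<bar>r t\<bar>) \<le> 2 * \<bar>W0 t + k\<bar> * ((u t)\<^sup>2 * \<bar>r t\<bar>)"
        by (intro mult_right_mono) auto
      moreover have "norm (w t * \<rho> t) = W0 t * ((u t)\<^sup>2 * \<bar>r t\<bar>)"
        using True W0_ge1[OF True] by (simp add: w_def \<rho>_def abs_mult)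
      moreover have "norm (2 * (u t * v t * r t)) = 2 * \<bar>W0 t + k\<bar> * (\<bar>u t\<bar>\<^sup>2 * \<bar>r t\<bar>)"
        unfolding v_eq[OF True] by (simp only: real_norm_def abs_mult power2_eq_square mult_ac abs_numeral)
      ultimately show ?thesis by (simp add: ind)
    qed (simp add: \<rho>_def)
  qed
qed

sublocale weighted_moment w \<rho>
proof
  show "w t \<ge> 0" for t using w_ge1[of t] by linarith
  show "\<rho> t \<ge> 0" for t by (simp add: \<rho>_def)
qed (fact w_measurable \<rho>_measurable w\<rho>_int)+

text \<open>The constant \<open>k\<close> in v = u (W + k) cancels, so the iteration kernel depends
  on W and \<open>u\<close> only.\<close>

lemma kernel_eq:
  assumes "x \<in> X" "t \<in> X"
  shows "u t * v x - v t * u x = - (u x * (u t * (w t - w x)))"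
  using assms by (simp add: v_eq w_def algebra_simps)

definition E :: real where "E = (LINT t|lebesgue. w t * \<rho> t)"

lemma E_nonneg: "E \<ge> 0"
  unfolding E_def using w_pos \<rho>_nonneg by (intro Bochner_Integration.integral_nonneg) auto

text \<open>For t < x the kernel involves 0 < W(t) - W(x) \<le> W(t), so each iteration costs at
  most the factor \<open>E\<close>, the total mass of w \<rho>. The bound is uniform in x after
  division by \<open>u\<close>, and geometric growth suffices because only z near \<open>lam\<close>
  matters.\<close>

lemma phi_n_bound: "x \<in> X \<Longrightarrow> \<bar>phi_n a r u v n x\<bar> \<le> \<bar>u x\<bar> * E ^ n"
proof (induction n arbitrary: x)
  case 0
  then show ?case by simp
next
  case (Suc n)
  let ?A = "{t. a < ereal t \<and> t < x}"
  let ?f = "\<lambda>t. indicat_real ?A t *\<^sub>R ((u t * v x - v t * u x) * phi_n a r u v n t * r t)"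
  have "\<bar>phi_n a r u v (Suc n) x\<bar> = norm (integral\<^sup>L lebesgue ?f)"
    by (simp add: set_lebesgue_integral_def)
  also have "\<dots> \<le> (LINT t|lebesgue. norm (?f t))"
    by (rule integral_norm_bound)
  also have "\<dots> \<le> (LINT t|lebesgue. \<bar>u x\<bar> * E ^ n * (w t * \<rho> t))"
  \<comment> \<open>This rule asks for integrability of the majorant alone. Were the left integrand
    not integrable, its integral would be 0 by convention, still below the nonnegative
    majorant.\<close>
  proof (rule integral_mono')
    show "integrable lebesgue (\<lambda>t. \<bar>u x\<bar> * E ^ n * (w t * \<rho> t))" using w\<rho>_int by simp
    fix t
    show "0 \<le> \<bar>u x\<bar> * E ^ n * (w t * \<rho> t)" using E_nonneg w_pos \<rho>_nonneg by simp
    show "norm (?f t) \<le> \<bar>u x\<bar> * E ^ n * (w t * \<rho> t)"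
    proof (cases "t \<in> ?A")
      case True
      then have t: "t \<in> X" "t < x" using Suc.prems by (auto simp: X_def)
      have wt: "\<bar>w t - w x\<bar> \<le> w t" using w_strict[OF t(1) Suc.prems t(2)] w_pos[of x] by linarith
      have "norm (?f t) = (\<bar>u x\<bar> * \<bar>u t\<bar> * \<bar>r t\<bar>) * (\<bar>w t - w x\<bar> * \<bar>phi_n a r u v n t\<bar>)"
        unfolding kernel_eq[OF Suc.prems t(1)] using True by (simp add: abs_mult)
      also have "\<dots> \<le> (\<bar>u x\<bar> * \<bar>u t\<bar> * \<bar>r t\<bar>) * (w t * (\<bar>u t\<bar> * E ^ n))"
        using wt Suc.IH[OF t(1)] w_pos by (intro mult_left_mono mult_mono) auto
      also have "\<dots> = \<bar>u x\<bar> * E ^ n * (w t * \<rho> t)"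
        using t(1) by (simp add: \<rho>_def power2_eq_square mult_ac)
      finally show ?thesis .
    next
      case False
      then show ?thesis using E_nonneg w_pos \<rho>_nonneg by simp
    qed
  qed
  also have "\<dots> = \<bar>u x\<bar> * E ^ Suc n" by (simp add: E_def)
  finally show ?case .
qed

text \<open>Only \<open>r > 0\<close> almost everywhere is known, whereas \<open>\<rho>\<close> is built from \<open>\<bar>r\<bar>\<close> to be nonnegative everywhere.\<close>
lemma phi_1_eq:
  assumes x: "x \<in> X"
  shows "phi_n a r u v (Suc 0) x = - (u x * excess (w x))"
proof -
  let ?A = "{t. a < ereal t \<and> t < x}"
  let ?\<rho> = "\<lambda>t. if t \<in> X then (u t)\<^sup>2 * r t else 0"
  have meas: "?\<rho> \<in> borel_measurable lebesgue"
    by (rule measurable_extend) (use u_meas r_meas in measurable)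
  obtain N where N: "negligible N" "\<And>x. x \<in> ivl a b - N \<Longrightarrow> p x > 0 \<and> r x > 0"
    using SL_setting_negligible[OF setting] by blast
  have "phi_n a r u v (Suc 0) x = (LINT t|lebesgue. indicat_real ?A t *\<^sub>R ((u t * v x - v t * u x) * u t * r t))"
    by (simp add: set_lebesgue_integral_def)
  \<comment> \<open>On \<open>X\<close> the factor \<open>w t - min (w t) (w x)\<close> vanishes for
    t \<ge> x, so it replaces the indicator of t < x.\<close>
  also have "\<dots> = (LINT t|lebesgue. - u x * ((w t - min (w t) (w x)) * ?\<rho> t))"
  proof (rule Bochner_Integration.integral_cong[OF refl])
    fix t
    show "indicat_real ?A t *\<^sub>R ((u t * v x - v t * u x) * u t * r t) = - u x * ((w t - min (w t) (w x)) * ?\<rho> t)"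
    proof (cases "t \<in> ?A")
      case True
      then have t: "t \<in> X" "t < x" using x by (auto simp: X_def)
      then show ?thesis using True w_strict[OF t(1) x t(2)]
        unfolding kernel_eq[OF x t(1)] by (simp add: power2_eq_square min_def)
    next
      case False
      then have "t \<in> X \<Longrightarrow> w t \<le> w x" using x by (intro w_antimono) (auto simp: X_def)
      then show ?thesis using False by (auto simp: min_def)
    qed
  qed
  also have "\<dots> = (LINT t|lebesgue. - u x * ((w t - min (w t) (w x)) * \<rho> t))"
  proof (rule integral_cong_AE)
    have "AE t in lebesgue. ?\<rho> t = \<rho> t"
      unfolding eventually_ae_filter_negligible
      using N(1) N(2)[OF DiffI[OF subsetD[OF X_sub]]]
      by (intro exI[of _ N] conjI subsetI) (force simp: \<rho>_def split: if_splits)+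
    then show "AE t in lebesgue. - u x * ((w t - min (w t) (w x)) * ?\<rho> t) = - u x * ((w t - min (w t) (w x)) * \<rho> t)"
      by eventually_elim simp
  qed (use meas in measurable)
  also have "\<dots> = - (u x * excess (w x))" by (simp add: excess_def)
  finally show ?thesis .
qed

text \<open>The condition on \<open>e\<close> makes the power series dominated by |u x| (1/2)^n. Its
  terms 0 and 1 give u (1 - e N), and the tail from n = 2 on is at most 2 |u| (e E)^2, with
  constants that do not depend on x.\<close>

lemma phi_real:
  assumes x: "x \<in> X" and e: "\<bar>e\<bar> * E \<le> 1 / 2"
  shows "phi a r u v lam (complex_of_real (lam + e)) x = complex_of_real (\<Sum>n. phi_n a r u v n x * e ^ n)"
    and "summable (\<lambda>n. phi_n a r u v n x * e ^ n)"
    and "\<bar>P (lam + e) x / u x - (1 - e * excess (w x))\<bar> \<le> 2 * E\<^sup>2 * e\<^sup>2"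
proof -
  have bd: "\<bar>phi_n a r u v n x * e ^ n\<bar> \<le> \<bar>u x\<bar> * (\<bar>e\<bar> * E) ^ n" for n
    using mult_right_mono[OF phi_n_bound[OF x, of n], of "\<bar>e\<bar> ^ n"]
    by (simp add: abs_mult power_abs power_mult_distrib mult_ac)
  have ge: "0 \<le> \<bar>e\<bar> * E" "\<bar>e\<bar> * E < 1" using E_nonneg e by auto
  have sumg: "summable (\<lambda>n. \<bar>u x\<bar> * (\<bar>e\<bar> * E) ^ n)"
    using ge by (intro summable_mult summable_geometric) auto
  show sm: "summable (\<lambda>n. phi_n a r u v n x * e ^ n)"
    by (rule summable_comparison_test'[OF sumg, of 0]) (use bd in auto)
  have eq: "complex_of_real (phi_n a r u v n x) * (complex_of_real (lam + e) - complex_of_real lam) ^ n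
     = complex_of_real (phi_n a r u v n x * e ^ n)" for n by simp
  show *: "phi a r u v lam (complex_of_real (lam + e)) x = complex_of_real (\<Sum>n. phi_n a r u v n x * e ^ n)"
    unfolding phi_def eq by (rule suminf_of_real[OF sm, symmetric])
  have split: "(\<Sum>n. phi_n a r u v n x * e ^ n) = (\<Sum>n. phi_n a r u v (n + 2) x * e ^ (n + 2)) + (\<Sum>n<2. phi_n a r u v n x * e ^ n)"
    by (rule suminf_split_initial_segment[OF sm])
  have two: "(\<Sum>n<2. phi_n a r u v n x * e ^ n) = u x * (1 - e * excess (w x))"
    using phi_1_eq[OF x] by (simp add: numeral_2_eq_2 algebra_simps del: phi_n.simps(2))
  have tb: "norm (phi_n a r u v (n + 2) x * e ^ (n + 2)) \<le> \<bar>u x\<bar> * (\<bar>e\<bar> * E)\<^sup>2 * (1 / 2) ^ n" for n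
  proof -
    have "norm (phi_n a r u v (n + 2) x * e ^ (n + 2)) \<le> \<bar>u x\<bar> * ((\<bar>e\<bar> * E)\<^sup>2 * (\<bar>e\<bar> * E) ^ n)"
      using bd[of "n + 2"] unfolding real_norm_def power_add[of "\<bar>e\<bar> * E" n 2]
      by (simp only: mult.commute[of "(\<bar>e\<bar> * E) ^ n"])
    also have "\<dots> \<le> \<bar>u x\<bar> * ((\<bar>e\<bar> * E)\<^sup>2 * (1 / 2) ^ n)"
      using ge e by (intro mult_left_mono power_mono) auto
    finally show ?thesis by (simp add: mult_ac)
  qed
  have "norm (\<Sum>n. phi_n a r u v (n + 2) x * e ^ (n + 2)) \<le> (\<Sum>n. \<bar>u x\<bar> * (\<bar>e\<bar> * E)\<^sup>2 * (1 / 2) ^ n)"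
    by (rule norm_suminf_le) (use tb in \<open>auto intro!: summable_mult summable_geometric\<close>)
  also have "\<dots> = \<bar>u x\<bar> * (\<bar>e\<bar> * E)\<^sup>2 * 2"
    by (subst suminf_mult) (auto simp: suminf_geometric summable_geometric)
  finally have tail: "\<bar>P (lam + e) x - u x * (1 - e * excess (w x))\<bar> \<le> \<bar>u x\<bar> * (2 * E\<^sup>2 * e\<^sup>2)"
    unfolding * split two by (simp add: power_mult_distrib mult_ac)
  have "P (lam + e) x / u x - (1 - e * excess (w x)) = (P (lam + e) x - u x * (1 - e * excess (w x))) / u x"
    using u_nz[OF x] by (simp add: diff_divide_distrib)
  then show "\<bar>P (lam + e) x / u x - (1 - e * excess (w x))\<bar> \<le> 2 * E\<^sup>2 * e\<^sup>2"
    using tail u_nz[OF x] by (simp add: abs_divide pos_divide_le_eq mult_ac)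
qed

end

section \<open>Differentiation in the spectral parameter\<close>

lemma has_real_derivative_quadratic_bound:
  fixes F :: "real \<Rightarrow> real"
  assumes \<delta>: "\<delta> > 0" and bd: "\<And>e. \<bar>e\<bar> < \<delta> \<Longrightarrow> \<bar>F e - F 0 - e * D\<bar> \<le> K * e\<^sup>2"
  shows "(F has_real_derivative D) (at 0)"
proof -
  have "((\<lambda>h. (F h - F 0) / h - D) \<longlongrightarrow> 0) (at 0)"
  proof (rule Lim_null_comparison)
    show "((\<lambda>h. K * \<bar>h\<bar>) \<longlongrightarrow> 0) (at (0::real))" by (auto intro!: tendsto_eq_intros)
    show "\<forall>\<^sub>F h in at 0. norm ((F h - F 0) / h - D) \<le> K * \<bar>h\<bar>"
      unfolding eventually_at
    proof (intro exI[of _ \<delta>] conjI ballI impI \<delta>)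
      fix h :: real assume "h \<noteq> 0 \<and> dist h 0 < \<delta>"
      then have h: "h \<noteq> 0" "\<bar>h\<bar> < \<delta>" by (auto simp: dist_real_def)
      have "(F h - F 0) / h - D = (F h - F 0 - h * D) / h"
        using h by (simp add: diff_divide_distrib)
      then have "norm ((F h - F 0) / h - D) = \<bar>F h - F 0 - h * D\<bar> / \<bar>h\<bar>"
        by (simp only: real_norm_def abs_divide)
      also have "\<dots> \<le> K * h\<^sup>2 / \<bar>h\<bar>" using bd[OF h(2)] by (rule divide_right_mono) simp
      also have "h\<^sup>2 = \<bar>h\<bar> * \<bar>h\<bar>" by (simp add: power2_eq_square)
      also have "K * (\<bar>h\<bar> * \<bar>h\<bar>) / \<bar>h\<bar> = K * \<bar>h\<bar>"
        using h by (simp del: abs_mult_self_eq)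
      finally show "norm ((F h - F 0) / h - D) \<le> K * \<bar>h\<bar>" .
    qed
  qed
  then have "((\<lambda>h. (F h - F 0) / h) \<longlongrightarrow> D) (at 0)" by (rule LIM_zero_cancel)
  then show ?thesis by (simp add: DERIV_def)
qed

text \<open>Turns inequalities valid for small e > 0, with equality at e = 0, into inequalities
  between the derivatives at 0.\<close>

lemma has_real_derivative_nonneg_right:
  fixes g :: "real \<Rightarrow> real"
  assumes D: "(g has_real_derivative D) (at 0)" and g0: "g 0 = 0"
    and ev: "\<forall>\<^sub>F e in at_right 0. g e \<ge> 0"
  shows "D \<ge> 0"
proof (rule ccontr)
  assume "\<not> D \<ge> 0"
  then obtain d where d: "d > 0" "\<And>h. h > 0 \<Longrightarrow> h < d \<Longrightarrow> g (0 + h) < g 0"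
    using has_real_derivative_neg_dec_right[OF D] by auto
  obtain d' where d': "d' > 0" "\<And>h. h > 0 \<Longrightarrow> h < d' \<Longrightarrow> g h \<ge> 0"
    using ev unfolding eventually_at_right_field by auto
  define h where "h = min d d' / 2"
  have "h > 0" "h < d" "h < d'" using d d' by (auto simp: h_def)
  then show False using d(2)[of h] d'(2)[of h] g0 by simp
qed

context regularization_near_endpoint
begin

definition h :: "real \<Rightarrow> real" where "h x = theta_coeff theta lam 1 x / u x"

text \<open>Here the holomorphy of \<open>theta\<close> enters, for each x separately: the complex
  derivative is restricted to the real axis and its real part taken.\<close>

lemma T_derivative:
  assumes "x \<in> ivl a b"
  shows "((\<lambda>e. T (lam + e) x) has_real_derivative theta_coeff theta lam 1 x) (at 0)"
proof -
  let ?D = "deriv (\<lambda>z. theta z x) (complex_of_real lam)"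
  have "(\<lambda>z. theta z x) field_differentiable at (complex_of_real lam)"
    using theta_entire assms holomorphic_on_imp_differentiable_at[of _ UNIV] by blast
  then have "((\<lambda>z. theta z x) has_field_derivative ?D) (at (complex_of_real lam))"
    by (simp add: DERIV_deriv_iff_field_differentiable)
  then have "((\<lambda>s. theta (complex_of_real s) x) has_vector_derivative ?D) (at lam)"
    by (rule has_vector_derivative_real_field)
  then have "((\<lambda>s. T s x) has_real_derivative Re ?D) (at (0 + lam))"
    unfolding has_real_derivative_iff_has_vector_derivative
    using bounded_linear.has_vector_derivative[OF bounded_linear_Re] by simp
  then have "((\<lambda>e. T (e + lam) x) has_real_derivative Re ?D) (at 0)"
    by (subst (asm) DERIV_shift)
  then show ?thesis by (simp add: theta_coeff_def add.commute)
qed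

lemma small_parameter: "\<bar>e\<bar> < 1 / (2 * (E + 1)) \<Longrightarrow> \<bar>e\<bar> * E \<le> 1 / 2"
proof -
  assume "\<bar>e\<bar> < 1 / (2 * (E + 1))"
  then have "\<bar>e\<bar> * (2 * (E + 1)) \<le> 1" using E_nonneg by (simp add: pos_less_divide_eq)
  then have "2 * (\<bar>e\<bar> * E) + 2 * \<bar>e\<bar> \<le> 1" by (simp add: algebra_simps)
  then show ?thesis by linarith
qed

lemma P_derivative:
  assumes x: "x \<in> X"
  shows "((\<lambda>e. P (lam + e) x) has_real_derivative - (u x * excess (w x))) (at 0)"
proof (rule has_real_derivative_quadratic_bound[where \<delta>="1 / (2 * (E + 1))" and K="\<bar>u x\<bar> * (2 * E\<^sup>2)"])
  show "0 < 1 / (2 * (E + 1))" using E_nonneg by simp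
  fix e :: real assume "\<bar>e\<bar> < 1 / (2 * (E + 1))"
  then have e: "\<bar>e\<bar> * E \<le> 1 / 2" by (rule small_parameter)
  have "P (lam + e) x - P (lam + 0) x - e * - (u x * excess (w x))
     = u x * (P (lam + e) x / u x - (1 - e * excess (w x)))"
    using u_nz[OF x] by (simp add: phi_lam algebra_simps)
  then have "\<bar>P (lam + e) x - P (lam + 0) x - e * - (u x * excess (w x))\<bar>
     = \<bar>u x\<bar> * \<bar>P (lam + e) x / u x - (1 - e * excess (w x))\<bar>"
    by (simp only: abs_mult)
  also have "\<dots> \<le> \<bar>u x\<bar> * (2 * E\<^sup>2 * e\<^sup>2)"
    using phi_real(3)[OF x e] by (rule mult_left_mono) simp
  finally show "\<bar>P (lam + e) x - P (lam + 0) x - e * - (u x * excess (w x))\<bar> \<le> \<bar>u x\<bar> * (2 * E\<^sup>2) * e\<^sup>2"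
    by (simp add: mult.assoc)
qed

text \<open>Quotient rule with phi_1 = -u N: (theta_1 u + theta_0 u N)/u^2 = h + W N.\<close>

lemma quotient_derivative:
  assumes x: "x \<in> X"
  shows "((\<lambda>e. T (lam + e) x / P (lam + e) x) has_real_derivative (h x + w x * excess (w x))) (at 0)"
proof -
  have "x \<in> ivl a b" using x X_sub by blast
  from DERIV_divide[OF T_derivative[OF this] P_derivative[OF x]] u_nz[OF x]
  have "((\<lambda>e. T (lam + e) x / P (lam + e) x) has_real_derivative
     (theta_coeff theta lam 1 x * u x - T lam x * - (u x * excess (w x))) / (u x * u x)) (at 0)"
    by (simp add: phi_lam)
  moreover have "(theta_coeff theta lam 1 x * u x - T lam x * - (u x * excess (w x))) / (u x * u x)
     = h x + w x * excess (w x)"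
    using u_nz[OF x] x by (simp add: h_def w_def W0_def add_divide_distrib)
  ultimately show ?thesis by simp
qed

lemma excess_w_mono: "x \<in> X \<Longrightarrow> y \<in> X \<Longrightarrow> x \<le> y \<Longrightarrow> excess (w x) \<le> excess (w y)"
  using excess_antimono w_antimono w_pos by blast

text \<open>If \<beta> \<le> phi/u \<le> \<alpha> on [x, y], then 1/phi^2 lies between 1/(\<alpha>^2
  u^2) and 1/(\<beta>^2 u^2), and the comparison of quotients transfers this to the increments of
  theta/phi and W.\<close>

lemma quotient_bounds:
  assumes xy: "x \<in> X" "y \<in> X" "x \<le> y" and e: "e > 0" "e * E \<le> 1 / 2"
    and pos: "1 - e * excess (w y) - 2 * E\<^sup>2 * e\<^sup>2 > 0"
  shows "1 / (1 - e * excess (w x) + 2 * E\<^sup>2 * e\<^sup>2)\<^sup>2 * (w x - w y)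
       \<le> T (lam + e) x / P (lam + e) x - T (lam + e) y / P (lam + e) y"
    and "T (lam + e) x / P (lam + e) x - T (lam + e) y / P (lam + e) y
       \<le> 1 / (1 - e * excess (w y) - 2 * E\<^sup>2 * e\<^sup>2)\<^sup>2 * (w x - w y)"
proof -
  \<comment> \<open>N increases with x and e > 0, so 1 - e N is largest at \<open>x\<close> and
    smallest at \<open>y\<close>; the quadratic term is the error from
    \<open>phi_real\<close>.\<close>
  define \<alpha> where "\<alpha> = 1 - e * excess (w x) + 2 * E\<^sup>2 * e\<^sup>2"
  define \<beta> where "\<beta> = 1 - e * excess (w y) - 2 * E\<^sup>2 * e\<^sup>2"
  have \<beta>: "\<beta> > 0" using pos by (simp add: \<beta>_def)
  have e': "\<bar>e\<bar> * E \<le> 1 / 2" using e by simp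
  have sub: "{x..y} \<subseteq> X" "{x..y} \<subseteq> ivl a b" using X_Icc[OF xy(1,2)] X_sub by auto
  have F: "\<beta> \<le> P (lam + e) t / u t" "P (lam + e) t / u t \<le> \<alpha>" if t: "t \<in> {x..y}" for t
  proof -
    have tX: "t \<in> X" using sub t by blast
    have "excess (w x) \<le> excess (w t)" "excess (w t) \<le> excess (w y)"
      using t tX xy by (auto intro!: excess_w_mono)
    then have "e * excess (w x) \<le> e * excess (w t)" "e * excess (w t) \<le> e * excess (w y)"
      using e(1) by auto
    moreover have "\<bar>P (lam + e) t / u t - (1 - e * excess (w t))\<bar> \<le> 2 * E\<^sup>2 * e\<^sup>2"
      by (rule phi_real(3)[OF tX e'])
    ultimately show "\<beta> \<le> P (lam + e) t / u t" "P (lam + e) t / u t \<le> \<alpha>"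
      unfolding \<alpha>_def \<beta>_def by linarith+
  qed
  have unz: "u t \<noteq> 0" if "t \<in> {x..y}" for t using u_nz sub that by blast
  have Pnz: "P (lam + e) t \<noteq> 0" if "t \<in> {x..y}" for t using F(1)[OF that] \<beta> by auto
  obtain g1 g2 where g: "is_sol a b p q r lam (T lam) g1" "is_sol a b p q r lam u g2"
    "\<And>x. x \<in> ivl a b \<Longrightarrow> T lam x * g2 x - g1 x * u x = 1" using base_solutions by blast
  obtain k1 k2 where k: "is_sol a b p q r (lam + e) (T (lam + e)) k1" "is_sol a b p q r (lam + e) (P (lam + e)) k2"
    "\<And>x. x \<in> ivl a b \<Longrightarrow> Im (phi a r u v lam (complex_of_real (lam + e)) x) = 0 \<Longrightarrow>
       T (lam + e) x * k2 x - k1 x * P (lam + e) x = 1" using real_solutions by blast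
  have Wk: "T (lam + e) t * k2 t - k1 t * P (lam + e) t = 1" if "t \<in> {x..y}" for t
  proof (rule k(3))
    show "t \<in> ivl a b" using that sub by blast
    have "t \<in> X" using that sub by blast
    then show "Im (phi a r u v lam (complex_of_real (lam + e)) t) = 0"
      using phi_real(1)[OF _ e'] by (simp only: Im_complex_of_real)
  qed
  have Wg: "T lam t * g2 t - g1 t * u t = 1" if "t \<in> {x..y}" for t using g(3) sub that by blast
  have w: "w x = T lam x / u x" "w y = T lam y / u y" using xy by (auto simp: w_def W0_def)
  have P2: "(P (lam + e) t)\<^sup>2 = (P (lam + e) t / u t)\<^sup>2 * (u t)\<^sup>2" if "t \<in> {x..y}" for t
    using unz[OF that] by (simp add: power_divide)
  have "1 / \<alpha>\<^sup>2 * (T lam x / u x - T lam y / u y) \<le> 1 * (T (lam + e) x / P (lam + e) x - T (lam + e) y / P (lam + e) y)"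
  proof (rule solution_quotient_compare[OF setting k(1,2) g(1,2) xy(3) sub(2) Pnz unz Wk Wg])
    fix t assume t: "t \<in> {x..y}"
    have "(P (lam + e) t / u t)\<^sup>2 \<le> \<alpha>\<^sup>2" using F[OF t] \<beta> by (intro power_mono) auto
    then have "(P (lam + e) t)\<^sup>2 \<le> \<alpha>\<^sup>2 * (u t)\<^sup>2"
      unfolding P2[OF t] by (rule mult_right_mono) simp
    then show "1 / \<alpha>\<^sup>2 / (u t)\<^sup>2 \<le> 1 / (P (lam + e) t)\<^sup>2"
      using Pnz[OF t] by (simp add: frac_le)
  qed
  then show "1 / (1 - e * excess (w x) + 2 * E\<^sup>2 * e\<^sup>2)\<^sup>2 * (w x - w y)
       \<le> T (lam + e) x / P (lam + e) x - T (lam + e) y / P (lam + e) y"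
    by (simp add: w \<alpha>_def)
  have "1 * (T (lam + e) x / P (lam + e) x - T (lam + e) y / P (lam + e) y) \<le> 1 / \<beta>\<^sup>2 * (T lam x / u x - T lam y / u y)"
  proof (rule solution_quotient_compare[OF setting g(1,2) k(1,2) xy(3) sub(2) unz Pnz Wg Wk])
    fix t assume t: "t \<in> {x..y}"
    have "\<beta>\<^sup>2 \<le> (P (lam + e) t / u t)\<^sup>2" using F[OF t] \<beta> by (intro power_mono) auto
    then have "\<beta>\<^sup>2 * (u t)\<^sup>2 \<le> (P (lam + e) t)\<^sup>2"
      unfolding P2[OF t] by (rule mult_right_mono) simp
    then show "1 / (P (lam + e) t)\<^sup>2 \<le> 1 / \<beta>\<^sup>2 / (u t)\<^sup>2"
      using unz[OF t] \<beta> by (simp add: frac_le)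
  qed
  then show "T (lam + e) x / P (lam + e) x - T (lam + e) y / P (lam + e) y
       \<le> 1 / (1 - e * excess (w y) - 2 * E\<^sup>2 * e\<^sup>2)\<^sup>2 * (w x - w y)"
    by (simp add: w \<beta>_def)
qed

lemma eventually_small:
  "\<forall>\<^sub>F e in at_right 0. e > 0 \<and> e * E \<le> 1 / 2 \<and> 1 - e * n - 2 * E\<^sup>2 * e\<^sup>2 > 0"
proof -
  have "((\<lambda>e. 1 - e * n - 2 * E\<^sup>2 * e\<^sup>2) \<longlongrightarrow> 1 - 0 * n - 2 * E\<^sup>2 * 0\<^sup>2) (at_right 0)"
    by (intro tendsto_intros)
  then have "\<forall>\<^sub>F e in at_right 0. 1 - e * n - 2 * E\<^sup>2 * e\<^sup>2 > 0"
    by (rule order_tendstoD) simp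
  moreover have "((\<lambda>e. e * E) \<longlongrightarrow> 0 * E) (at_right 0)"
    by (intro tendsto_intros)
  then have "\<forall>\<^sub>F e in at_right 0. e * E < 1 / 2"
    by (rule order_tendstoD) simp
  moreover have "\<forall>\<^sub>F e in at_right (0::real). e > 0" by (rule eventually_at_right_less)
  ultimately show ?thesis by eventually_elim simp
qed

text \<open>At e = 0 all three members of \<open>quotient_bounds\<close> equal W(x) - W(y), so their
  derivatives in e from the right inherit the order.\<close>

lemma h_increment_bounds:
  assumes xy: "x \<in> X" "y \<in> X" "x \<le> y"
  shows "2 * excess (w x) * (w x - w y) \<le> (h x + w x * excess (w x)) - (h y + w y * excess (w y))"
    and "(h x + w x * excess (w x)) - (h y + w y * excess (w y)) \<le> 2 * excess (w y) * (w x - w y)"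
proof -
  let ?R = "\<lambda>e t. T (lam + e) t / P (lam + e) t"
  \<comment> \<open>Source of the factor 2: (1 - e n)^(-2) has derivative 2 n at 0, to which the
    quadratic term adds nothing.\<close>
  have inv: "((\<lambda>e::real. 1 / (1 - e * n + K * e\<^sup>2)\<^sup>2) has_real_derivative 2 * n) (at 0)" for n K :: real
    by (auto intro!: derivative_eq_intros)
  have R0: "?R 0 x - ?R 0 y = w x - w y"
    using xy by (simp add: phi_lam w_def W0_def)
  have "0 \<le> (h x + w x * excess (w x)) - (h y + w y * excess (w y)) - 2 * excess (w x) * (w x - w y)"
  proof (rule has_real_derivative_nonneg_right)
    show "((\<lambda>e. (?R e x - ?R e y) - 1 / (1 - e * excess (w x) + 2 * E\<^sup>2 * e\<^sup>2)\<^sup>2 * (w x - w y)) has_real_derivative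
      (h x + w x * excess (w x)) - (h y + w y * excess (w y)) - 2 * excess (w x) * (w x - w y)) (at 0)"
      by (intro DERIV_diff DERIV_cmult_right quotient_derivative xy inv)
    show "\<forall>\<^sub>F e in at_right 0. 0 \<le> (?R e x - ?R e y) - 1 / (1 - e * excess (w x) + 2 * E\<^sup>2 * e\<^sup>2)\<^sup>2 * (w x - w y)"
      using eventually_small[of "excess (w y)"] by eventually_elim (use quotient_bounds(1)[OF xy] in auto)
  qed (use R0 in simp)
  then show "2 * excess (w x) * (w x - w y) \<le> (h x + w x * excess (w x)) - (h y + w y * excess (w y))" by simp
  have inv': "((\<lambda>e::real. 1 / (1 - e * n - K * e\<^sup>2)\<^sup>2) has_real_derivative 2 * n) (at 0)" for n K :: real
    using inv[of n "- K"] by simp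
  have "0 \<le> 2 * excess (w y) * (w x - w y) - ((h x + w x * excess (w x)) - (h y + w y * excess (w y)))"
  proof (rule has_real_derivative_nonneg_right)
    show "((\<lambda>e. 1 / (1 - e * excess (w y) - 2 * E\<^sup>2 * e\<^sup>2)\<^sup>2 * (w x - w y) - (?R e x - ?R e y)) has_real_derivative
      2 * excess (w y) * (w x - w y) - ((h x + w x * excess (w x)) - (h y + w y * excess (w y)))) (at 0)"
      by (intro DERIV_diff DERIV_cmult_right quotient_derivative xy inv')
    show "\<forall>\<^sub>F e in at_right 0. 0 \<le> 1 / (1 - e * excess (w y) - 2 * E\<^sup>2 * e\<^sup>2)\<^sup>2 * (w x - w y) - (?R e x - ?R e y)"
      using eventually_small[of "excess (w y)"] by eventually_elim (use quotient_bounds(2)[OF xy] in auto)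
  qed (use R0 in simp)
  then show "(h x + w x * excess (w x)) - (h y + w y * excess (w y)) \<le> 2 * excess (w y) * (w x - w y)" by simp
qed

text \<open>After moving W N to the other side, \<open>h_increment_bounds\<close> confines the
  increment of h to the interval that \<open>truncated_diff_bounds\<close> gives for
  \<open>truncated\<close>. The difference of the two is at most its width, whence
  \<open>K = 2\<close>, and bisection makes it vanish.\<close>

lemma h_increment:
  assumes xy: "x \<in> X" "y \<in> X" "x \<le> y"
  shows "h x - h y = truncated (w x) - truncated (w y)"
proof -
  have "h x - truncated (w x) = h y - truncated (w y)"
  proof (rule increment_product_bound_imp_eq[OF xy(3), where W=w and N="\<lambda>t. excess (w t)" and K=2])
    have sub: "{x..y} \<subseteq> X" by (rule X_Icc[OF xy(1,2)])
    show "continuous_on {x..y} w" by (rule continuous_on_subset[OF w_continuous sub])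
    show "w t \<le> w s" if "x \<le> s" "s \<le> t" "t \<le> y" for s t
      using that sub by (intro w_antimono) (auto simp: subset_eq)
    show "\<bar>(h s - truncated (w s)) - (h t - truncated (w t))\<bar> \<le> 2 * ((w s - w t) * (excess (w t) - excess (w s)))"
      if "x \<le> s" "s \<le> t" "t \<le> y" for s t
    proof -
      have st: "s \<in> X" "t \<in> X" using that sub by (auto simp: subset_eq)
      have le: "0 \<le> w t" "w t \<le> w s" using w_pos w_antimono[OF st that(2)] by auto
      show ?thesis
        using h_increment_bounds[OF st that(2)] truncated_diff_bounds[OF le]
        by (simp add: algebra_simps abs_le_iff)
    qed
  qed
  then show ?thesis by simp
qed

end

section \<open>The limit circle case and the regularization index\<close>

text \<open>The index is finite as soon as one limit is nonzero: the predecessor of the first such n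
  satisfies the condition under \<open>LEAST\<close>, which is therefore attained.\<close>

lemma reg_index_eq_0_iff:
  assumes "Lim F (\<lambda>x. ereal (phi0 x / th 0 x)) = 0"
  shows "reg_index F phi0 th = 0 \<longleftrightarrow> Lim F (\<lambda>x. ereal (phi0 x / th 1 x)) \<noteq> 0"
proof -
  define L where "L n = Lim F (\<lambda>x. ereal (phi0 x / th n x))" for n
  have L0: "L 0 = 0" using assms by (simp add: L_def)
  define Q where "Q l \<longleftrightarrow> (\<forall>n\<le>l. L n = 0) \<and> L (Suc l) \<noteq> 0" for l
  have reg: "reg_index F phi0 th = (if \<forall>n. L n = 0 then \<infinity> else enat (LEAST l. Q l))"
    unfolding reg_index_def L_def Q_def Let_def by simp
  show ?thesis
  proof (cases "\<forall>n. L n = 0")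
    case True
    then show ?thesis unfolding reg by (simp flip: L_def)
  next
    case False
    define m where "m = (LEAST n. L n \<noteq> 0)"
    have "\<exists>n. L n \<noteq> 0" using False by blast
    then have m: "L m \<noteq> 0" unfolding m_def by (rule LeastI_ex)
    have below: "L n = 0" if "n < m" for n
      using not_less_Least[OF that[unfolded m_def]] by blast
    have "m \<noteq> 0" using L0 m by metis
    \<comment> \<open>The vanishing limit at 0 forces \<open>m \<ge> 1\<close>, so the subtraction
      is genuine.\<close>
    then have "Q (m - 1)" using m below unfolding Q_def by simp
    then have "Q (LEAST l. Q l)" by (rule LeastI)
    then have "(LEAST l. Q l) = 0 \<Longrightarrow> L 1 \<noteq> 0" by (auto simp: Q_def)
    moreover have "L 1 \<noteq> 0 \<Longrightarrow> (LEAST l. Q l) = 0" using L0 by (simp add: Q_def)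
    ultimately show ?thesis using False unfolding reg by (auto simp: zero_enat_def simp flip: L_def)
  qed
qed

text \<open>Covers the compact part of an interval away from a, where local integrability of
  \<open>r\<close> is enough.\<close>

lemma absolutely_integrable_continuous_weight:
  fixes F :: "real \<Rightarrow> real"
  assumes S: "SL_setting a b p q r" and cont: "continuous_on (ivl a b) F" and sub: "{c..d} \<subseteq> ivl a b"
  shows "(\<lambda>x. F x * r x) absolutely_integrable_on {c..d}"
proof -
  have r: "r absolutely_integrable_on {c..d}" using S sub unfolding SL_setting_def L1_loc_def by blast
  have cont': "continuous_on {c..d} F" by (rule continuous_on_subset[OF cont sub])
  then have "bounded (F ` {c..d})" using compact_continuous_image compact_imp_bounded compact_Icc by blast
  then show ?thesis
    using absolutely_integrable_bounded_measurable_product_real[OF continuous_imp_measurable_on_sets_lebesgue[OF cont'] _ _ r]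
    by simp
qed

context regularization_near_endpoint
begin

section \<open>The limit circle case as square integrability of theta_0\<close>

lemma T_lam_eq: "x \<in> X \<Longrightarrow> T lam x = u x * w x"
  using u_nz by (simp add: w_def W0_def)

lemma w2\<rho>_eq: "(w t)\<^sup>2 * \<rho> t = (if t \<in> X then (T lam t)\<^sup>2 * \<bar>r t\<bar> else 0)"
  by (auto simp: T_lam_eq \<rho>_def power_mult_distrib)

lemma measurable_on_ivl:
  fixes f :: "real \<Rightarrow> complex"
  assumes "continuous_on (ivl a b) f" "A \<in> sets lebesgue" "A \<subseteq> ivl a b"
  shows "(\<lambda>x. (cmod (f x))\<^sup>2 * r x) \<in> borel_measurable (lebesgue_on A)"
proof -
  have "(\<lambda>x. (cmod (f x))\<^sup>2) \<in> borel_measurable (lebesgue_on A)"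
    using assms by (intro continuous_imp_measurable_on_sets_lebesgue continuous_intros)
      (auto intro: continuous_on_subset)
  moreover have "r \<in> borel_measurable (lebesgue_on A)"
    using setting measurable_restrict_mono[OF _ assms(3)] unfolding SL_setting_def by blast
  ultimately show ?thesis by (rule borel_measurable_times)
qed

text \<open>At \<open>mu = lam\<close> the solutions theta_0 and \<open>u\<close> form a basis, and
  |u| \<le> |theta_0| near a, so theta_0^2 |r| dominates every solution there up to a
  constant.\<close>

lemma square_integrable_imp_limit_circle:
  assumes "integrable lebesgue (\<lambda>t. (w t)\<^sup>2 * \<rho> t)"
  shows "limit_circle_at_a a b p q r"
  unfolding limit_circle_at_a_def
proof (intro exI[of _ "complex_of_real lam"] allI impI; elim conjE)
  fix f g c' assume f: "is_sol a b p q r (complex_of_real lam) f g" and c': "c' \<in> ivl a b"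
  obtain G1 G2 where G: "is_sol a b p q r (complex_of_real lam) (theta (complex_of_real lam)) G1"
    "is_sol a b p q r (complex_of_real lam) (phi a r u v lam (complex_of_real lam)) G2"
    "\<And>x. x \<in> ivl a b \<Longrightarrow> theta (complex_of_real lam) x * G2 x - G1 x * phi a r u v lam (complex_of_real lam) x = 1"
    using theta_sol by blast
  obtain C where C: "C \<ge> 0" "\<And>x. x \<in> ivl a b \<Longrightarrow> cmod (f x) \<le> C * (cmod (theta (complex_of_real lam) x) + cmod (phi a r u v lam (complex_of_real lam) x))"
    using solution_bound_same_parameter[OF f G] by blast
  have bd: "cmod (f x) \<le> 2 * C * \<bar>T lam x\<bar>" if x: "x \<in> X" for x
  proof -
    have xi: "x \<in> ivl a b" using X_sub x by blast
    then have "Im (theta (complex_of_real lam) x) = 0" using theta_real complex_is_Real_iff by blast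
    then have "cmod (theta (complex_of_real lam) x) = \<bar>T lam x\<bar>" by (simp add: cmod_eq_Re)
    moreover have "\<bar>u x\<bar> \<le> \<bar>T lam x\<bar>"
      using T_lam_eq[OF x] w_ge1[of x] by (simp add: abs_mult mult_le_cancel_left1)
    ultimately have "cmod (theta (complex_of_real lam) x) + cmod (phi a r u v lam (complex_of_real lam) x) \<le> 2 * \<bar>T lam x\<bar>"
      by (simp add: phi_lam)
    from mult_left_mono[OF this C(1)] C(2)[OF xi] show ?thesis by simp
  qed
  have 1: "(\<lambda>x. (cmod (f x))\<^sup>2 * r x) absolutely_integrable_on X"
  proof (rule measurable_bounded_by_integrable_imp_absolutely_integrable)
    show "(\<lambda>x. (cmod (f x))\<^sup>2 * r x) \<in> borel_measurable (lebesgue_on X)"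
      by (rule measurable_on_ivl[OF is_solD(5)[OF f] X_lebesgue X_sub])
    show "X \<in> sets lebesgue" by (rule X_lebesgue)
    have "integrable lebesgue (\<lambda>t. (2 * C)\<^sup>2 * ((w t)\<^sup>2 * \<rho> t))" using assms by simp
    then have "set_integrable lebesgue X (\<lambda>t. (2 * C)\<^sup>2 * ((w t)\<^sup>2 * \<rho> t))"
      unfolding set_integrable_def by (rule integrable_mult_indicator[OF X_lebesgue])
    then show "(\<lambda>t. (2 * C)\<^sup>2 * ((w t)\<^sup>2 * \<rho> t)) integrable_on X"
      by (rule set_lebesgue_integral_eq_integral)
    fix x assume x: "x \<in> X"
    have "(cmod (f x))\<^sup>2 \<le> (2 * C * \<bar>T lam x\<bar>)\<^sup>2" using bd[OF x] by (intro power_mono) auto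
    then have "(cmod (f x))\<^sup>2 * \<bar>r x\<bar> \<le> (2 * C * \<bar>T lam x\<bar>)\<^sup>2 * \<bar>r x\<bar>" by (rule mult_right_mono) simp
    then show "norm ((cmod (f x))\<^sup>2 * r x) \<le> (2 * C)\<^sup>2 * ((w x)\<^sup>2 * \<rho> x)"
      unfolding w2\<rho>_eq using x by (simp add: abs_mult power_mult_distrib mult_ac)
  qed
  obtain y1 where y1: "y1 \<in> ivl a b" "y1 < y0" using smaller_point[OF y0(1)] by blast
  have 2: "(\<lambda>x. (cmod (f x))\<^sup>2 * r x) absolutely_integrable_on {y1..c'}"
    by (rule absolutely_integrable_continuous_weight[OF setting _ Icc_subset_ivl[OF y1(1) c']])
       (use is_solD(5)[OF f] in \<open>auto intro!: continuous_intros\<close>)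
  have "(\<lambda>x. (cmod (f x))\<^sup>2 * r x) absolutely_integrable_on (X \<union> {y1..c'})"
    using 1 2 X_lebesgue by (intro set_integrable_Un) auto
  moreover have "{x. a < ereal x \<and> x < c'} \<subseteq> X \<union> {y1..c'}" using y1 by (auto simp: X_def)
  moreover have "{x. a < ereal x \<and> x < c'} \<in> sets lebesgue"
  proof -
    have "{x. a < ereal x \<and> x < c'} = ivl a (ereal c')" by (auto simp: ivl_def)
    then show ?thesis by (simp add: open_ivl borel_open)
  qed
  ultimately show "(\<lambda>x. (cmod (f x))\<^sup>2 * r x) absolutely_integrable_on {x. a < ereal x \<and> x < c'}"
    by (metis set_integrable_subset)
qed

text \<open>The definition supplies some complex \<open>mu\<close>, possibly different from
  \<open>lam\<close>. The basis \<open>theta mu\<close>, \<open>phi mu\<close> is square integrable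
  near a, and variation of constants bounds theta_0 by it.\<close>

lemma limit_circle_imp_square_integrable:
  assumes "limit_circle_at_a a b p q r"
  shows "integrable lebesgue (\<lambda>t. (w t)\<^sup>2 * \<rho> t)"
proof -
  obtain mu :: complex where mu: "\<And>f g c. is_sol a b p q r mu f g \<Longrightarrow> c \<in> ivl a b \<Longrightarrow>
        (\<lambda>x. (cmod (f x))\<^sup>2 * r x) absolutely_integrable_on {x. a < ereal x \<and> x < c}"
    using assms unfolding limit_circle_at_a_def by blast
  obtain G1 G2 where G: "is_sol a b p q r mu (theta mu) G1"
    "is_sol a b p q r mu (phi a r u v lam mu) G2"
    "\<And>x. x \<in> ivl a b \<Longrightarrow> theta mu x * G2 x - G1 x * phi a r u v lam mu x = 1"
    using theta_sol by blast
  obtain H where H: "is_sol a b p q r (complex_of_real lam) (theta (complex_of_real lam)) H"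
    using theta_sol by blast
  let ?f = "theta mu" and ?g = "phi a r u v lam mu"
  note fint = mu[OF G(1) y0(1)] and gint = mu[OF G(2) y0(1)]
  obtain c1 C where c1: "c1 \<in> ivl a b" "c1 < y0" and C: "C \<ge> 0"
    and bd: "\<And>x. x \<in> ivl a b \<Longrightarrow> x \<le> c1 \<Longrightarrow> cmod (theta (complex_of_real lam) x) \<le> C * (cmod (?f x) + cmod (?g x))"
    using solution_bound_other_parameter[OF H G y0(1) fint gint] by blast
  let ?A = "ivl a (ereal c1)"
  have Asub: "?A \<subseteq> X" "?A \<subseteq> ivl a b" using c1(2) X_sub by (auto simp: X_def ivl_def)
  have Aleb: "?A \<in> sets lebesgue" by (simp add: open_ivl borel_open)
  have "(\<lambda>x. (cmod (theta (complex_of_real lam) x))\<^sup>2 * r x) absolutely_integrable_on ?A"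
  proof (rule measurable_bounded_by_integrable_imp_absolutely_integrable[OF _ Aleb])
    show "(\<lambda>x. (cmod (theta (complex_of_real lam) x))\<^sup>2 * r x) \<in> borel_measurable (lebesgue_on ?A)"
      by (rule measurable_on_ivl[OF is_solD(5)[OF H] Aleb Asub(2)])
    have "(\<lambda>x. norm ((cmod (?f x))\<^sup>2 * r x)) integrable_on ?A" "(\<lambda>x. norm ((cmod (?g x))\<^sup>2 * r x)) integrable_on ?A"
      using set_integrable_subset[OF fint[folded X_def] Aleb Asub(1)]
        set_integrable_subset[OF gint[folded X_def] Aleb Asub(1)]
      unfolding absolutely_integrable_on_def by blast+
    then show "(\<lambda>x. 2 * C\<^sup>2 * (norm ((cmod (?f x))\<^sup>2 * r x) + norm ((cmod (?g x))\<^sup>2 * r x))) integrable_on ?A"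
      by (intro integrable_on_mult_right integrable_add)
    fix x assume x: "x \<in> ?A"
    have "cmod (theta (complex_of_real lam) x) \<le> C * (cmod (?f x) + cmod (?g x))"
      using x Asub by (intro bd) (auto simp: ivl_def)
    then have "(cmod (theta (complex_of_real lam) x))\<^sup>2 \<le> (C * (cmod (?f x) + cmod (?g x)))\<^sup>2"
      by (intro power_mono) auto
    also have "\<dots> = C\<^sup>2 * (cmod (?f x) + cmod (?g x))\<^sup>2" by (simp add: power_mult_distrib)
    also have "\<dots> \<le> C\<^sup>2 * (2 * ((cmod (?f x))\<^sup>2 + (cmod (?g x))\<^sup>2))"
      using sum_squares_bound[of "cmod (?f x)" "cmod (?g x)"]
      by (intro mult_left_mono) (auto simp: power2_eq_square algebra_simps)
    finally have "(cmod (theta (complex_of_real lam) x))\<^sup>2 * \<bar>r x\<bar> \<le> C\<^sup>2 * (2 * ((cmod (?f x))\<^sup>2 + (cmod (?g x))\<^sup>2)) * \<bar>r x\<bar>"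
      by (rule mult_right_mono) simp
    then show "norm ((cmod (theta (complex_of_real lam) x))\<^sup>2 * r x) \<le> 2 * C\<^sup>2 * (norm ((cmod (?f x))\<^sup>2 * r x) + norm ((cmod (?g x))\<^sup>2 * r x))"
      by (simp add: abs_mult algebra_simps)
  qed
  moreover have "(\<lambda>x. (cmod (theta (complex_of_real lam) x))\<^sup>2 * r x) absolutely_integrable_on {c1..y0}"
    by (rule absolutely_integrable_continuous_weight[OF setting _ Icc_subset_ivl[OF c1(1) y0(1)]])
       (use is_solD(5)[OF H] in \<open>auto intro!: continuous_intros\<close>)
  ultimately have "(\<lambda>x. (cmod (theta (complex_of_real lam) x))\<^sup>2 * r x) absolutely_integrable_on (?A \<union> {c1..y0})"
    using Aleb by (intro set_integrable_Un) auto
  moreover have "X \<subseteq> ?A \<union> {c1..y0}" by (auto simp: X_def ivl_def)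
  ultimately have "(\<lambda>x. (cmod (theta (complex_of_real lam) x))\<^sup>2 * r x) absolutely_integrable_on X"
    using X_lebesgue by (metis set_integrable_subset)
  then have "integrable lebesgue (\<lambda>x. norm (indicat_real X x *\<^sub>R ((cmod (theta (complex_of_real lam) x))\<^sup>2 * r x)))"
    unfolding set_integrable_def by (rule integrable_norm)
  moreover have "norm (indicat_real X x *\<^sub>R ((cmod (theta (complex_of_real lam) x))\<^sup>2 * r x)) = (w x)\<^sup>2 * \<rho> x" for x
  proof (cases "x \<in> X")
    case True
    then have "Im (theta (complex_of_real lam) x) = 0" using theta_real complex_is_Real_iff X_sub by blast
    then show ?thesis unfolding w2\<rho>_eq using True by (simp add: cmod_eq_Re abs_mult)
  qed (simp add: \<rho>_def)
  ultimately show ?thesis by simp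
qed

text \<open>A zero integral would make its nonnegative integrand vanish almost everywhere, yet left
  of x it is positive almost everywhere, since W decreases strictly, \<open>u\<close> has no zero
  and r > 0. This is what makes h strictly decreasing.\<close>

lemma excess_pos:
  assumes x: "x \<in> X"
  shows "excess (w x) > 0"
proof (rule ccontr)
  assume "\<not> excess (w x) > 0"
  then have "excess (w x) = 0" using excess_nonneg[of "w x"] by simp
  moreover have "AE t in lebesgue. 0 \<le> (w t - min (w t) (w x)) * \<rho> t"
    using \<rho>_nonneg by (intro AE_I2) simp
  ultimately have "AE t in lebesgue. (w t - min (w t) (w x)) * \<rho> t = 0"
    unfolding excess_def by (simp only: integral_nonneg_eq_0_iff_AE[OF excess_integrable[OF w_pos]])
  then obtain N where N: "negligible N" "{t. (w t - min (w t) (w x)) * \<rho> t \<noteq> 0} \<subseteq> N"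
    unfolding eventually_ae_filter_negligible by blast
  obtain M where M: "negligible M" "\<And>x. x \<in> ivl a b - M \<Longrightarrow> p x > 0 \<and> r x > 0"
    using SL_setting_negligible[OF setting] by blast
  have "x \<in> ivl a b" using x X_sub by blast
  then obtain y where y: "y \<in> ivl a b" "y < x" using smaller_point by blast
  have "{y<..<x} \<subseteq> N \<union> M"
  proof
    fix t assume t: "t \<in> {y<..<x}"
    have tX: "t \<in> X" using t y x less_trans[of a "ereal y" "ereal t"] by (auto simp: X_def ivl_def)
    show "t \<in> N \<union> M"
    proof (rule ccontr)
      assume n: "t \<notin> N \<union> M"
      then have "r t > 0" using M(2)[of t] tX X_sub by blast
      then have "\<rho> t \<noteq> 0" using tX u_nz[OF tX] by (simp add: \<rho>_def)
      moreover have "w t - min (w t) (w x) \<noteq> 0" using w_strict[OF tX x] t by auto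
      ultimately show False using N(2) n by auto
    qed
  qed
  moreover have "negligible (N \<union> M)" using N M by simp
  ultimately show False
    using negligible_subset open_not_negligible[of "{y<..<x}"] y(2) by (metis dense empty_iff greaterThanLessThan_iff open_greaterThanLessThan)
qed

lemma h_strict_decreasing:
  assumes "x \<in> X" "y \<in> X" "x < y"
  shows "h y < h x"
proof -
  have lt: "w y < w x" "0 \<le> w y" using w_strict[OF assms] w_pos by auto
  have "0 < excess (w x) * (w x - w y)" using excess_pos[OF assms(1)] lt by simp
  moreover have "0 \<le> w y * (excess (w y) - excess (w x))"
    using excess_w_mono[OF assms(1,2)] assms(3) lt by simp
  ultimately have "0 < truncated (w x) - truncated (w y)"
    using truncated_diff_bounds(1)[of "w y" "w x"] lt by linarith
  then show ?thesis using h_increment[OF assms(1,2)] assms(3) by simp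
qed

section \<open>Boundedness of h and the limit of u/theta_1\<close>

lemma eventually_X: "x1 \<in> X \<Longrightarrow> \<forall>\<^sub>F x in at_left_end a. x \<in> X \<and> x < x1"
  unfolding eventually_at_left_end[OF a_less_b] using X_sub by (auto simp: X_def intro!: bexI[of _ x1])

lemma X_nonempty: "\<exists>x. x \<in> X"
  using smaller_point[OF y0(1)] by (auto simp: X_def ivl_def)

text \<open>Holds also where theta_1 vanishes, since division by zero and the inverse of zero are
  both 0.\<close>

lemma quotient_theta_1: "x \<in> X \<Longrightarrow> u x / theta_coeff theta lam 1 x = inverse (h x)"
  by (simp add: h_def)

text \<open>h and \<open>truncated\<close> composed with \<open>w\<close> differ by a constant.
  Since W exceeds every integer near a, a bound on h bounds all integer truncations, and conversely
  the full integral bounds every truncation.\<close>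

lemma h_bounded_iff: "bdd_above (h ` X) \<longleftrightarrow> integrable lebesgue (\<lambda>t. (w t)\<^sup>2 * \<rho> t)"
proof
  obtain x1 where x1: "x1 \<in> X" using X_nonempty by blast
  have eq: "h x = h x1 + truncated (w x) - truncated (w x1)" if "x \<in> X" for x
    using h_increment[of x x1] h_increment[of x1 x] that x1 by (cases "x \<le> x1") auto
  {
    assume "bdd_above (h ` X)"
    then obtain B where B: "\<And>x. x \<in> X \<Longrightarrow> h x \<le> B" by (auto simp: bdd_above_def)
    have "truncated (real n) \<le> B - h x1 + truncated (w x1)" for n
    proof -
      have "\<forall>\<^sub>F x in at_left_end a. real n \<le> W0 x \<and> x \<in> X"
        using W0_at_top[unfolded filterlim_at_top, rule_format, of "real n"] eventually_X[OF x1]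
        by eventually_elim simp
      then obtain x where x: "real n \<le> W0 x" "x \<in> X"
        using eventually_happens'[OF at_left_end_neq_bot[OF a_less_b]] by blast
      then have "truncated (real n) \<le> truncated (w x)"
        by (intro truncated_mono) (auto simp: w_def)
      then show ?thesis using eq[OF x(2)] B[OF x(2)] by linarith
    qed
    then show "integrable lebesgue (\<lambda>t. (w t)\<^sup>2 * \<rho> t)" by (rule truncated_bounded_imp_integrable)
  }
  assume int: "integrable lebesgue (\<lambda>t. (w t)\<^sup>2 * \<rho> t)"
  show "bdd_above (h ` X)"
  proof (rule bdd_aboveI2)
    fix x assume "x \<in> X"
    then show "h x \<le> h x1 + (LINT t|lebesgue. (w t)\<^sup>2 * \<rho> t) - truncated (w x1)"
      using eq truncated_le[OF int w_pos[of x]] by simp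
  qed
qed

text \<open>Monotonicity upgrades unboundedness to divergence to +infinity at a.\<close>

lemma Lim_theta_1_unbounded:
  assumes "\<not> bdd_above (h ` X)"
  shows "Lim (at_left_end a) (\<lambda>x. ereal (u x / theta_coeff theta lam 1 x)) = 0"
proof -
  have "filterlim h at_top (at_left_end a)"
    unfolding filterlim_at_top
  proof
    fix B :: real
    obtain x1 where x1: "x1 \<in> X" "h x1 > B" using assms by (force simp: bdd_above_def not_le)
    from eventually_X[OF x1(1)] show "\<forall>\<^sub>F x in at_left_end a. B \<le> h x"
    proof eventually_elim
      case (elim x)
      then show ?case using h_strict_decreasing[of x x1] x1 by auto
    qed
  qed
  then have "((\<lambda>x. inverse (h x)) \<longlongrightarrow> 0) (at_left_end a)" by (rule tendsto_inverse_0_at_top)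
  moreover obtain x1 where "x1 \<in> X" using X_nonempty by blast
  from eventually_X[OF this] have "\<forall>\<^sub>F x in at_left_end a. inverse (h x) = u x / theta_coeff theta lam 1 x"
    by eventually_elim (metis quotient_theta_1)
  ultimately have "((\<lambda>x. u x / theta_coeff theta lam 1 x) \<longlongrightarrow> 0) (at_left_end a)"
    by (rule Lim_transform_eventually)
  then have "((\<lambda>x. ereal (u x / theta_coeff theta lam 1 x)) \<longlongrightarrow> ereal 0) (at_left_end a)" by simp
  from tendsto_Lim[OF at_left_end_neq_bot[OF a_less_b] this] show ?thesis
    by (simp only: zero_ereal_def)
qed

text \<open>A bounded decreasing h tends to its supremum \<open>L\<close> at a, so 1/h tends to 1/L,
  or to -infinity when \<open>L = 0\<close>; neither limit is 0.\<close>

lemma Lim_theta_1_bounded: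
  assumes bdd: "bdd_above (h ` X)"
  shows "Lim (at_left_end a) (\<lambda>x. ereal (u x / theta_coeff theta lam 1 x)) \<noteq> 0"
proof -
  define L where "L = Sup (h ` X)"
  obtain x0 where x0: "x0 \<in> X" using X_nonempty by blast
  have le: "h x \<le> L" if "x \<in> X" for x unfolding L_def using that bdd by (intro cSup_upper) auto
  have lt: "h x < L" if x: "x \<in> X" for x
  proof -
    have "x \<in> ivl a b" using x X_sub by blast
    then obtain y where y: "y \<in> ivl a b" "y < x" using smaller_point by blast
    then have "y \<in> X" using x by (auto simp: X_def ivl_def)
    then show ?thesis using h_strict_decreasing[of y x] le[of y] x y by simp
  qed
  have hL: "(h \<longlongrightarrow> L) (at_left_end a)"
  proof (rule order_tendstoI)
    fix l assume "l < L"
    then obtain x1 where x1: "x1 \<in> X" "l < h x1"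
      using less_cSup_iff[of "h ` X" l] bdd x0 unfolding L_def by auto
    from eventually_X[OF x1(1)] show "\<forall>\<^sub>F x in at_left_end a. l < h x"
    proof eventually_elim
      case (elim x)
      then show ?case using h_strict_decreasing[of x x1] x1 by auto
    qed
  next
    fix l assume "L < l"
    from eventually_X[OF x0] show "\<forall>\<^sub>F x in at_left_end a. h x < l"
      by eventually_elim (use lt \<open>L < l\<close> in force)
  qed
  have eq: "\<forall>\<^sub>F x in at_left_end a. ereal (inverse (h x)) = ereal (u x / theta_coeff theta lam 1 x)"
    using eventually_X[OF x0] by eventually_elim (metis quotient_theta_1)
  note tl = tendsto_Lim[OF at_left_end_neq_bot[OF a_less_b]]
  show ?thesis
  proof (cases "L = 0")
    case True
    \<comment> \<open>Here strictness matters: \<open>\<theta>\<^sub>1 = 0\<close> would make \<open>u/\<theta>\<^sub>1\<close> the junk value \<open>0\<close>.\<close>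
    have "\<forall>\<^sub>F x in at_left_end a. h x < 0"
      using eventually_X[OF x0] by eventually_elim (use lt True in auto)
    then have "filterlim (\<lambda>x. inverse (h x)) at_bot (at_left_end a)"
      using hL True by (intro filterlim_inverse_at_bot) auto
    then have "((\<lambda>x. ereal (inverse (h x))) \<longlongrightarrow> - \<infinity>) (at_left_end a)"
      by (simp only: ereal_tendsto_simps2(3)[unfolded comp_def])
    then have "((\<lambda>x. ereal (u x / theta_coeff theta lam 1 x)) \<longlongrightarrow> - \<infinity>) (at_left_end a)"
      using eq by (rule Lim_transform_eventually)
    from tl[OF this] show ?thesis by simp
  next
    case False
    then have "((\<lambda>x. ereal (inverse (h x))) \<longlongrightarrow> ereal (inverse L)) (at_left_end a)"
      using hL by (intro tendsto_intros) auto
    then have "((\<lambda>x. ereal (u x / theta_coeff theta lam 1 x)) \<longlongrightarrow> ereal (inverse L)) (at_left_end a)"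
      using eq by (rule Lim_transform_eventually)
    from tl[OF this] False show ?thesis by (simp add: zero_ereal_def)
  qed
qed

lemma limit_circle_iff_reg_index:
  "limit_circle_at_a a b p q r \<longleftrightarrow> reg_index (at_left_end a) u (theta_coeff theta lam) = 0"
proof -
  have "((\<lambda>x. ereal (u x / theta_coeff theta lam 0 x)) \<longlongrightarrow> ereal 0) (at_left_end a)"
    using u_over_T_lam by (simp add: theta_coeff_def)
  from tendsto_Lim[OF at_left_end_neq_bot[OF a_less_b] this]
  have "Lim (at_left_end a) (\<lambda>x. ereal (u x / theta_coeff theta lam 0 x)) = 0"
    by (simp only: zero_ereal_def)
  from reg_index_eq_0_iff[of "at_left_end a" u "theta_coeff theta lam", OF this]
  have "reg_index (at_left_end a) u (theta_coeff theta lam) = 0 \<longleftrightarrow> bdd_above (h ` X)"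
    using Lim_theta_1_bounded Lim_theta_1_unbounded by metis
  then show ?thesis
    unfolding h_bounded_iff using square_integrable_imp_limit_circle limit_circle_imp_square_integrable by blast
qed

end

theorem mainTheorem12:
  fixes a b :: ereal and p q r :: "real \<Rightarrow> real"
    and lam :: real and u v gu gv :: "real \<Rightarrow> real" and c :: real
    and theta :: "complex \<Rightarrow> real \<Rightarrow> complex"
  assumes setting: "SL_setting a b p q r"
    and nonosc: "nonosc_at_a a b p q r lam"
    and u_princ: "principal_at_a a b p q r lam u"
    and u_sol: "is_sol a b p q r lam u gu"
    and v_sol: "is_sol a b p q r lam v gv"
    and wronski: "\<forall>x\<in>ivl a b. v x * gu x - gv x * u x = 1"
    and c_in: "c \<in> ivl a b"
    and Ha_int: "(\<lambda>x. u x * v x * r x) absolutely_integrable_on {x. a < ereal x \<and> x < c}"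
    and theta_entire: "\<forall>x\<in>ivl a b. (\<lambda>z. theta z x) holomorphic_on UNIV"
    and theta_real: "\<forall>t::real. \<forall>x\<in>ivl a b. theta (complex_of_real t) x \<in> \<real>"
    and theta_sol: "\<forall>z. \<exists>g\<theta> g\<phi>. is_sol a b p q r z (theta z) g\<theta> \<and>
                      is_sol a b p q r z (phi a r u v lam z) g\<phi> \<and>
                      (\<forall>x\<in>ivl a b. theta z x * g\<phi> x - g\<theta> x * phi a r u v lam z x = 1)"
  shows "limit_circle_at_a a b p q r \<longleftrightarrow>
         reg_index (at_left_end a) u (theta_coeff theta lam) = 0"
proof -
  interpret regularization_setting a b p q r lam u v gu gv c theta
    by unfold_locales (fact assms)+
  obtain y0 k where "y0 \<in> ivl a b" "y0 \<le> c"
    "\<And>x. a < ereal x \<Longrightarrow> x < y0 \<Longrightarrow> u x \<noteq> 0 \<and> W0 x \<ge> 1 \<and> W0 x \<ge> 2 * \<bar>k\<bar> \<and> v x / u x = W0 x + k"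
    using region by blast
  then interpret regularization_near_endpoint a b p q r lam u v gu gv c theta y0 k
    by unfold_locales auto
  show ?thesis by (rule limit_circle_iff_reg_index)
qed

end
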